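(* Let $m\ge3$. Then, as a $\mathbb{C}$-algebra, the Terwilliger algebra $T$ of $2.O_{m+1}$ with respect to $x_0$ is isomorphic to $$\bigoplus_{d=0}^{m}\ \bigoplus_{r=1}^{\,m-d-\lceil (m-d)/2\rceil+1}\mathrm{Mat}_{2d+2}(\mathbb{C}),$$ i.e. to a direct sum in which, for each $d\in\{0,\dots,m\}$, the full matrix algebra $\mathrm{Mat}_{2d+2}(\mathbb{C})$ appears exactly $m-d-\lceil\frac{m-d}{2}\rceil+1$ times.
   Context: $S=\{1,\dots,2m+1\}$, $X=\binom{S}{m}\cup\binom{S}{m+1}$; the doubled Odd graph $2.O_{m+1}$ has vertex set $X$, two vertices adjacent iff one is a proper subset of the other, with distance $\partial$. $x_0=\{1,\dots,m\}$. $T=T(x_0)$ is the subalgebra of complex $X\times X$ matrices generated by the adjacency matrix $A_1$ and the dual idempotents $E^*_i$ ($0\le i\le 2m+1$), where $E^*_i$ is diagonal with $(y,y)$-entry $1$ iff $\partial(x_0,y)=i$. *)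

theory Defs
  imports Complex_Main "Jordan_Normal_Form.Matrix"
begin

definition S_set :: "nat \<Rightarrow> nat set" where
  "S_set m = {1..2*m+1}"

definition X_set :: "nat \<Rightarrow> nat set set" where
  "X_set m = {x. x \<subseteq> S_set m \<and> (card x = m \<or> card x = m + 1)}"

definition adj :: "nat \<Rightarrow> nat set \<Rightarrow> nat set \<Rightarrow> bool" where
  "adj m x y \<longleftrightarrow> x \<in> X_set m \<and> y \<in> X_set m \<and> (x \<subset> y \<or> y \<subset> x)"

definition edges :: "nat \<Rightarrow> (nat set \<times> nat set) set" where
  "edges m = {(x, y). adj m x y}"

definition gdist :: "nat \<Rightarrow> nat set \<Rightarrow> nat set \<Rightarrow> nat" where
  "gdist m x y = (LEAST n. (x, y) \<in> (edges m) ^^ n)"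

definition x0 :: "nat \<Rightarrow> nat set" where
  "x0 m = {1..m}"

type_synonym xmat = "nat set \<Rightarrow> nat set \<Rightarrow> complex"

definition A1 :: "nat \<Rightarrow> xmat" where
  "A1 m = (\<lambda>y z. if adj m y z then 1 else 0)"

definition Estar :: "nat \<Rightarrow> nat \<Rightarrow> xmat" where
  "Estar m i = (\<lambda>y z. if y = z \<and> y \<in> X_set m \<and> gdist m (x0 m) y = i then 1 else 0)"

definition xadd :: "xmat \<Rightarrow> xmat \<Rightarrow> xmat" where
  "xadd M N = (\<lambda>y z. M y z + N y z)"

definition xsmult :: "complex \<Rightarrow> xmat \<Rightarrow> xmat" where
  "xsmult c M = (\<lambda>y z. c * M y z)"

definition xmult :: "nat \<Rightarrow> xmat \<Rightarrow> xmat \<Rightarrow> xmat" where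
  "xmult m M N = (\<lambda>y z. \<Sum>w\<in>X_set m. M y w * N w z)"

inductive_set Terwilliger :: "nat \<Rightarrow> xmat set" for m where
  gen_A: "A1 m \<in> Terwilliger m"
| gen_E: "i \<le> 2*m+1 \<Longrightarrow> Estar m i \<in> Terwilliger m"
| add: "M \<in> Terwilliger m \<Longrightarrow> N \<in> Terwilliger m \<Longrightarrow> xadd M N \<in> Terwilliger m"
| smult: "M \<in> Terwilliger m \<Longrightarrow> xsmult c M \<in> Terwilliger m"
| mult: "M \<in> Terwilliger m \<Longrightarrow> N \<in> Terwilliger m \<Longrightarrow> xmult m M N \<in> Terwilliger m"

definition blocks :: "nat \<Rightarrow> (nat \<times> nat) set" where
  "blocks m = {(d, r). d \<le> m \<and> 1 \<le> r \<and>
      int r \<le> int m - int d - \<lceil>real (m - d) / 2\<rceil> + 1}"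

definition dsum_alg :: "nat \<Rightarrow> (nat \<times> nat \<Rightarrow> complex mat) set" where
  "dsum_alg m = {B. (\<forall>p \<in> blocks m. B p \<in> carrier_mat (2 * fst p + 2) (2 * fst p + 2))
                   \<and> (\<forall>p. p \<notin> blocks m \<longrightarrow> B p = 0\<^sub>m 0 0)}"

definition dadd :: "(nat \<times> nat \<Rightarrow> complex mat) \<Rightarrow> (nat \<times> nat \<Rightarrow> complex mat) \<Rightarrow> (nat \<times> nat \<Rightarrow> complex mat)" where
  "dadd B C = (\<lambda>p. B p + C p)"

definition dsmult :: "complex \<Rightarrow> (nat \<times> nat \<Rightarrow> complex mat) \<Rightarrow> (nat \<times> nat \<Rightarrow> complex mat)" where
  "dsmult c B = (\<lambda>p. c \<cdot>\<^sub>m B p)"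

definition dmult :: "(nat \<times> nat \<Rightarrow> complex mat) \<Rightarrow> (nat \<times> nat \<Rightarrow> complex mat) \<Rightarrow> (nat \<times> nat \<Rightarrow> complex mat)" where
  "dmult B C = (\<lambda>p. B p * C p)"

end

theory Submission
  imports Defs "HOL-Library.Function_Algebras"
begin

text \<open>Spheres around \<open>x\<^sub>0\<close> are products of two Boolean-lattice levels, and the edges between consecutive spheres
  alternately move in the lattice of \<open>x\<^sub>0\<close> and in that of its complement. Multiplying lowest-weight
  vectors of the two lattices, of weights \<open>j\<close> and \<open>k\<close>, gives a function \<open>\<chi>\<^sub>j\<^sub>k\<close> whose restrictions to the spheres
  span a \<open>T\<close>-module on which \<open>A\<^sub>1\<close> is tridiagonal. The products of opposite off-diagonal entries distinguish
  the pairs \<open>(j, k)\<close>, so interpolation puts all matrix units in the image of \<open>T\<close> in the direct sum of the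
  matrix algebras of these modules. Conversely \<open>T\<close> consists of matrices invariant under the stabiliser of
  \<open>x\<^sub>0\<close>, and the orbit matrices of that group are parametrised by the same finite set as the matrix units;
  comparing dimensions shows that the surjection is injective.\<close>

section \<open>Spheres around the base vertex\<close>

text \<open>The obstacle is faithfulness: reading it off the action would mean proving that copies
  of the modules exhaust all functions on \<open>X_set m\<close>. Counting avoids this, so a single
  module for each \<open>(j, k)\<close> suffices and neither an inner product nor semisimplicity
  enters. The counts agree for the following reason. Subsets of sizes \<open>a\<close> and
  \<open>b\<close> of an \<open>n\<close>-set have \<open>min(a, b, n-a, n-b) + 1\<close> possible
  intersection sizes. A weight \<open>w\<close> lives on level \<open>a\<close> exactly when
  \<open>w \<le> a \<le> n - w\<close>, so just as many weights live on both levels.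

  Separation works because the edges on the two sides of a sphere move in different lattices. A step
  to one neighbouring sphere and back acts on the module of \<open>(j, k)\<close> by a quadratic in
  \<open>j\<close> alone, and through the other neighbouring sphere by a quadratic in
  \<open>k\<close> alone. The bounds \<open>2 * j \<le> m\<close> and
  \<open>2 * k \<le> m + 1\<close> keep the weights on one branch of these quadratics.

  The size \<open>2 * d + 2\<close> is the number of spheres that a module meets: they form the
  interval from \<open>m - d\<close> to \<open>m + d + 1\<close>.\<close>

definition C_set :: "nat \<Rightarrow> nat set" where
  "C_set m = {m+1..2*m+1}"

text \<open>On the way out from the base vertex, points of the complement are inserted and points of
  \<open>x0 m\<close> removed in turn, so even radii carry the \<open>m\<close>-sets and odd radii
  the \<open>(m+1)\<close>-sets. Truncated subtraction makes \<open>level m (2*m+2)\<close> equal to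
  \<open>level m (2*m+1)\<close>, which is why the bound \<open>p \<le> 2*m+1\<close> accompanies
  statements about uniqueness.\<close>

definition level :: "nat \<Rightarrow> nat \<Rightarrow> nat set set" where
  "level m p = {y. y \<subseteq> S_set m \<and> card (y \<inter> x0 m) = m - p div 2 \<and> card (y \<inter> C_set m) = (p + 1) div 2}"

lemma finite_x0 [simp]: "finite (x0 m)" and finite_C [simp]: "finite (C_set m)"
  and finite_S_set [simp]: "finite (S_set m)"
  by (auto simp: x0_def C_set_def S_set_def)

lemma card_x0 [simp]: "card (x0 m) = m" and card_C [simp]: "card (C_set m) = m + 1"
  by (auto simp: x0_def C_set_def)

lemma S_eq: "S_set m = x0 m \<union> C_set m" and x0_C_disj: "x0 m \<inter> C_set m = {}"
  by (auto simp: x0_def C_set_def S_set_def)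

lemma finite_X [simp]: "finite (X_set m)"
  unfolding X_set_def by (rule finite_subset[of _ "Pow (S_set m)"]) auto

lemma card_split:
  assumes "y \<subseteq> S_set m"
  shows "card y = card (y \<inter> x0 m) + card (y \<inter> C_set m)"
proof -
  have "y = (y \<inter> x0 m) \<union> (y \<inter> C_set m)" using assms S_eq by blast
  moreover have "(y \<inter> x0 m) \<inter> (y \<inter> C_set m) = {}" using x0_C_disj by blast
  ultimately show ?thesis by (metis card_Un_disjoint finite_C finite_Int finite_x0)
qed

lemma card_Int_x0_le: "card (y \<inter> x0 m) \<le> m"
  by (metis card_mono card_x0 finite_x0 inf_le2)

lemma level_cards:
  assumes "y \<in> level m p"
  shows "y \<subseteq> S_set m" "finite y" "card (y \<inter> x0 m) = m - p div 2" "card (y \<inter> C_set m) = (p + 1) div 2"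
  using assms finite_subset[of y "S_set m"] by (auto simp: level_def)

lemma card_level:
  assumes "y \<in> level m p" "p \<le> 2*m+1"
  shows "card y = (if even p then m else m + 1)"
proof -
  have "card y = (m - p div 2) + (p+1) div 2"
    using card_split[of y m] level_cards[OF assms(1)] by simp
  then show ?thesis using assms(2) by (auto elim!: evenE oddE)
qed

lemma level_subset_X: "p \<le> 2*m+1 \<Longrightarrow> level m p \<subseteq> X_set m"
proof
  fix y assume "p \<le> 2*m+1" "y \<in> level m p"
  then show "y \<in> X_set m"
    using card_level[of y m p] level_cards(1)[of y m p] by (cases "even p") (simp_all add: X_set_def)
qed

lemma finite_level [simp]: "finite (level m p)"
  unfolding level_def by (rule finite_subset[of _ "Pow (S_set m)"]) auto

lemma X_level:
  assumes "y \<in> X_set m"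
  obtains p where "p \<le> 2*m+1" "y \<in> level m p"
proof -
  have y: "y \<subseteq> S_set m" "card y = m \<or> card y = m + 1" using assms by (auto simp: X_set_def)
  note le = card_Int_x0_le[of y m]
  show thesis
  proof (cases "card y = m")
    case True
    show ?thesis
      by (rule that[of "2 * (m - card (y \<inter> x0 m))"]) (use True y card_split[OF y(1)] le in \<open>auto simp: level_def\<close>)
  next
    case False
    show ?thesis
      by (rule that[of "2 * (m - card (y \<inter> x0 m)) + 1"]) (use False y card_split[OF y(1)] le in \<open>auto simp: level_def\<close>)
  qed
qed

lemma level_unique:
  assumes "y \<in> level m p" "y \<in> level m q" "p \<le> 2*m+1" "q \<le> 2*m+1"
  shows "p = q"
proof -
  have "m - p div 2 = m - q div 2" "(p+1) div 2 = (q+1) div 2"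
    using level_cards(3,4)[OF assms(1)] level_cards(3,4)[OF assms(2)] by simp_all
  moreover have "p div 2 \<le> m" "q div 2 \<le> m" using assms(3,4) by simp_all
  ultimately have "p div 2 = q div 2" by linarith
  moreover have "n = n div 2 + (n + 1) div 2" for n :: nat by presburger
  ultimately show ?thesis using \<open>(p+1) div 2 = (q+1) div 2\<close> by metis
qed

lemma X_eq_Union_level: "X_set m = (\<Union>p\<le>2*m+1. level m p)"
proof
  show "X_set m \<subseteq> (\<Union>p\<le>2*m+1. level m p)"
  proof
    fix y assume "y \<in> X_set m"
    then obtain p where "p \<le> 2*m+1" "y \<in> level m p" by (rule X_level)
    then show "y \<in> (\<Union>p\<le>2*m+1. level m p)" by blast
  qed
  show "(\<Union>p\<le>2*m+1. level m p) \<subseteq> X_set m"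
    using level_subset_X by blast
qed

lemma sum_X_levels:
  fixes f :: "nat set \<Rightarrow> complex"
  shows "(\<Sum>z\<in>X_set m. f z) = (\<Sum>p\<le>2*m+1. \<Sum>z\<in>level m p. f z)"
  unfolding X_eq_Union_level
proof (rule sum.UNION_disjoint)
  show "\<forall>p\<in>{..2*m+1}. \<forall>q\<in>{..2*m+1}. p \<noteq> q \<longrightarrow> level m p \<inter> level m q = {}"
    using level_unique by (metis atMost_iff disjoint_iff)
qed simp_all

section \<open>Edges between consecutive spheres\<close>

lemma psubset_insert:
  assumes "y \<subset> z" "finite z" "card z = card y + 1"
  obtains x where "x \<notin> y" "z = insert x y"
proof -
  have "card (z - y) = 1"
    using assms card_Diff_subset[of y z] finite_subset[of y z] by auto
  then obtain x where "z - y = {x}" by (auto simp: card_1_singleton_iff)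
  then show thesis using that[of x] assms by blast
qed

lemma insert_C_level:
  assumes "y \<in> level m p" "even p" "x \<in> C_set m - y"
  shows "insert x y \<in> level m (Suc p)"
proof -
  have "x \<notin> x0 m" using assms(3) x0_C_disj by blast
  then have "insert x y \<inter> x0 m = y \<inter> x0 m" "insert x y \<inter> C_set m = insert x (y \<inter> C_set m)"
    using assms by auto
  then show ?thesis using assms level_cards[OF assms(1)] S_eq by (auto simp: level_def elim!: evenE)
qed

lemma insert_x0_level:
  assumes "y \<in> level m (Suc p)" "odd p" "x \<in> x0 m - y" "p \<le> 2*m"
  shows "insert x y \<in> level m p"
proof -
  have "x \<notin> C_set m" using assms(3) x0_C_disj by blast
  then have "insert x y \<inter> C_set m = y \<inter> C_set m" "insert x y \<inter> x0 m = insert x (y \<inter> x0 m)"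
    using assms by auto
  then show ?thesis using assms level_cards[OF assms(1)] S_eq by (auto simp: level_def elim!: oddE)
qed

lemma remove_C_level:
  assumes "y \<in> level m (Suc p)" "even p" "x \<in> y \<inter> C_set m"
  shows "y - {x} \<in> level m p"
proof -
  have "x \<notin> x0 m" using assms(3) x0_C_disj by blast
  then have "(y - {x}) \<inter> x0 m = y \<inter> x0 m" "(y - {x}) \<inter> C_set m = (y \<inter> C_set m) - {x}"
    using assms by auto
  then show ?thesis using assms level_cards[OF assms(1)] S_eq by (auto simp: level_def elim!: evenE)
qed

lemma remove_x0_level:
  assumes "y \<in> level m p" "odd p" "x \<in> y \<inter> x0 m" "p \<le> 2*m"
  shows "y - {x} \<in> level m (Suc p)"
proof -
  have "x \<notin> C_set m" using assms(3) x0_C_disj by blast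
  then have "(y - {x}) \<inter> C_set m = y \<inter> C_set m" "(y - {x}) \<inter> x0 m = (y \<inter> x0 m) - {x}"
    using assms by auto
  then show ?thesis using assms level_cards[OF assms(1)] S_eq by (auto simp: level_def elim!: oddE)
qed

text \<open>Cardinality forces the direction: every neighbour of an \<open>m\<close>-set is obtained
  by inserting one point. Inserting a point of \<open>x0 m\<close> needs one to be missing, which
  excludes radius 0.\<close>

lemma adj_cases_even:
  assumes "y \<in> level m p" "even p" "p \<le> 2*m+1" "adj m y z"
  obtains x where "x \<in> C_set m - y" "z = insert x y"
  | x where "x \<in> x0 m - y" "z = insert x y" "p > 0"
proof -
  have cy: "card y = m" using card_level[OF assms(1,3)] assms(2) by simp
  have z: "z \<subseteq> S_set m" "card z = m \<or> card z = m + 1" "y \<subset> z \<or> z \<subset> y"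
    using assms(4) by (auto simp: adj_def X_set_def)
  have fin: "finite z" "finite y" using finite_subset[OF z(1)] level_cards(2)[OF assms(1)] by auto
  have "z \<subset> y \<Longrightarrow> card z < card y" "y \<subset> z \<Longrightarrow> card y < card z"
    using psubset_card_mono fin by blast+
  then have "y \<subset> z" "card z = card y + 1" using z(2,3) cy by linarith+
  then obtain x where x: "x \<notin> y" "z = insert x y" using psubset_insert fin(1) by metis
  have "p > 0" if "x \<in> x0 m"
  proof (rule ccontr)
    assume "\<not> p > 0"
    then have "card (y \<inter> x0 m) = m" using level_cards[OF assms(1)] by simp
    then have "y \<inter> x0 m = x0 m" by (simp add: card_subset_eq)
    then show False using that x by auto
  qed
  then show thesis using that x z(1) S_eq by blast
qed

lemma adj_cases_odd:
  assumes "y \<in> level m p" "odd p" "p \<le> 2*m+1" "adj m y z"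
  obtains x where "x \<in> y \<inter> C_set m" "z = y - {x}"
  | x where "x \<in> y \<inter> x0 m" "z = y - {x}" "p \<le> 2*m"
proof -
  have cy: "card y = m + 1" using card_level[OF assms(1,3)] assms(2) by simp
  have z: "z \<subseteq> S_set m" "card z = m \<or> card z = m + 1" "y \<subset> z \<or> z \<subset> y"
    using assms(4) by (auto simp: adj_def X_set_def)
  have fin: "finite z" "finite y" using finite_subset[OF z(1)] level_cards(2)[OF assms(1)] by auto
  have "z \<subset> y \<Longrightarrow> card z < card y" "y \<subset> z \<Longrightarrow> card y < card z"
    using psubset_card_mono fin by blast+
  then have "z \<subset> y" "card y = card z + 1" using z(2,3) cy by linarith+
  then obtain x where x: "x \<notin> z" "y = insert x z" using psubset_insert fin(2) by metis
  have "p \<le> 2*m" if "x \<in> x0 m"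
  proof (rule ccontr)
    assume "\<not> p \<le> 2*m"
    then have "card (y \<inter> x0 m) = 0" using level_cards[OF assms(1)] assms(3) by simp
    then show False using that x fin by auto
  qed
  moreover have "z = y - {x}" "x \<in> y" using x by auto
  ultimately show thesis using that level_cards(1)[OF assms(1)] S_eq by blast
qed

lemma adj_sym: "adj m y z \<longleftrightarrow> adj m z y"
  by (auto simp: adj_def)

lemma adj_insert:
  assumes "y \<in> level m p" "insert x y \<in> level m q" "x \<notin> y" "p \<le> 2*m+1" "q \<le> 2*m+1"
  shows "adj m y (insert x y)"
  using assms level_subset_X by (auto simp: adj_def)

lemma adj_remove:
  assumes "y \<in> level m p" "y - {x} \<in> level m q" "x \<in> y" "p \<le> 2*m+1" "q \<le> 2*m+1"
  shows "adj m y (y - {x})"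
  using assms level_subset_X by (auto simp: adj_def)

lemma nbrs_even_up:
  assumes "y \<in> level m p" "even p" "p \<le> 2*m+1"
  shows "{z \<in> level m (Suc p). adj m y z} = (\<lambda>x. insert x y) ` (C_set m - y)"
proof -
  have p: "Suc p \<le> 2*m+1" using assms by presburger
  have "z \<in> (\<lambda>x. insert x y) ` (C_set m - y)" if z: "z \<in> level m (Suc p)" "adj m y z" for z
    using assms z(2)
  proof (cases rule: adj_cases_even)
    case (2 x)
    obtain q where q: "p = Suc q" using 2 by (cases p) auto
    then have "z \<in> level m q" using insert_x0_level[of y m q x] assms 2 by auto
    then show ?thesis using level_unique[OF z(1), of q] q p by auto
  qed auto
  then show ?thesis using insert_C_level[OF assms(1,2)] adj_insert[OF assms(1) _ _ assms(3) p] by blast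
qed

lemma nbrs_even_down:
  assumes "y \<in> level m (Suc p)" "odd p" "p \<le> 2*m"
  shows "{z \<in> level m p. adj m y z} = (\<lambda>x. insert x y) ` (x0 m - y)"
proof -
  have p: "Suc p \<le> 2*m+1" "Suc (Suc p) \<le> 2*m+1" using assms by presburger+
  have "z \<in> (\<lambda>x. insert x y) ` (x0 m - y)" if z: "z \<in> level m p" "adj m y z" for z
  proof (rule adj_cases_even[OF assms(1) _ p(1) z(2)])
    fix x assume x: "x \<in> C_set m - y" "z = insert x y"
    then have "z \<in> level m (Suc (Suc p))" using insert_C_level[of y m "Suc p" x] assms by auto
    then show ?thesis using level_unique[OF z(1), of "Suc (Suc p)"] p by auto
  qed (use assms in auto)
  moreover have "p \<le> 2*m+1" using p by simp
  ultimately show ?thesis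
    using insert_x0_level[OF assms(1,2) _ assms(3)] adj_insert[OF assms(1) _ _ p(1)] by blast
qed

lemma nbrs_odd_down:
  assumes "y \<in> level m (Suc p)" "even p" "p \<le> 2*m"
  shows "{z \<in> level m p. adj m y z} = (\<lambda>x. y - {x}) ` (y \<inter> C_set m)"
proof -
  have p: "Suc p \<le> 2*m+1" "p \<le> 2*m+1" using assms by presburger+
  have "z \<in> (\<lambda>x. y - {x}) ` (y \<inter> C_set m)" if z: "z \<in> level m p" "adj m y z" for z
  proof (rule adj_cases_odd[OF assms(1) _ p(1) z(2)])
    fix x assume x: "x \<in> y \<inter> x0 m" "z = y - {x}" and l: "Suc p \<le> 2*m"
    then have "z \<in> level m (Suc (Suc p))" using remove_x0_level[of y m "Suc p" x] assms by auto
    then show ?thesis using level_unique[OF z(1), of "Suc (Suc p)"] l by auto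
  qed (use assms in auto)
  then show ?thesis
    using remove_C_level[OF assms(1,2)] adj_remove[OF assms(1) _ _ p] by blast
qed

lemma nbrs_odd_up:
  assumes "y \<in> level m p" "odd p" "p \<le> 2*m"
  shows "{z \<in> level m (Suc p). adj m y z} = (\<lambda>x. y - {x}) ` (y \<inter> x0 m)"
proof -
  have p: "Suc p \<le> 2*m+1" "p \<le> 2*m+1" using assms by presburger+
  have "z \<in> (\<lambda>x. y - {x}) ` (y \<inter> x0 m)" if z: "z \<in> level m (Suc p)" "adj m y z" for z
  proof (rule adj_cases_odd[OF assms(1,2) p(2) z(2)])
    fix x assume x: "x \<in> y \<inter> C_set m" "z = y - {x}"
    obtain q where q: "p = Suc q" using assms by (cases p) auto
    then have "z \<in> level m q" using remove_C_level[of y m q x] assms x by auto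
    then show ?thesis using level_unique[OF z(1), of q] p q by auto
  qed auto
  then show ?thesis
    using remove_x0_level[OF assms(1,2) _ assms(3)] adj_remove[OF assms(1) _ _ p(2,1)] by blast
qed

lemma adj_level:
  assumes "y \<in> level m p" "z \<in> level m q" "p \<le> 2*m+1" "q \<le> 2*m+1" "adj m y z"
  shows "q = Suc p \<or> p = Suc q"
proof (cases "even p")
  case True
  from assms(1) True assms(3,5) show ?thesis
  proof (cases rule: adj_cases_even)
    case (1 x)
    then have "z \<in> level m (Suc p)" using insert_C_level assms True by auto
    moreover have "Suc p \<le> 2*m+1" using assms True by presburger
    ultimately show ?thesis using level_unique assms by blast
  next
    case (2 x)
    obtain r where r: "p = Suc r" using 2 by (cases p) auto
    then have "z \<in> level m r" using insert_x0_level[of y m r x] assms 2 True by auto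
    then show ?thesis using level_unique[OF assms(2), of r] r assms by auto
  qed
next
  case False
  from assms(1) False assms(3,5) show ?thesis
  proof (cases rule: adj_cases_odd)
    case (1 x)
    obtain r where r: "p = Suc r" using False by (cases p) auto
    then have "z \<in> level m r" using remove_C_level[of y m r x] assms 1 False by auto
    then show ?thesis using level_unique[OF assms(2), of r] r assms by auto
  next
    case (2 x)
    then have "z \<in> level m (Suc p)" using remove_x0_level assms False by auto
    then show ?thesis using level_unique[OF assms(2), of "Suc p"] 2 assms by auto
  qed
qed

lemma level_pred:
  assumes "y \<in> level m (Suc p)" "p \<le> 2*m"
  obtains z where "z \<in> level m p" "adj m z y"
proof -
  have "{z \<in> level m p. adj m y z} \<noteq> {}"
  proof (cases "even p")
    case True
    have "card (y \<inter> C_set m) \<noteq> 0" using level_cards[OF assms(1)] True by auto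
    then have "y \<inter> C_set m \<noteq> {}" by auto
    then show ?thesis using nbrs_odd_down[OF assms(1) True assms(2)] by blast
  next
    case False
    have "card (y \<inter> x0 m) < m"
      using level_cards[OF assms(1)] False assms(2) by (auto elim!: oddE)
    then have "x0 m - y \<noteq> {}" using card_x0 by (metis Diff_eq_empty_iff inf.absorb2 nat_neq_iff)
    then show ?thesis using nbrs_even_down[OF assms(1) False assms(2)] by blast
  qed
  then show thesis using that adj_sym by blast
qed

lemma x0_level: "x0 m \<in> level m 0"
  using x0_C_disj S_eq by (auto simp: level_def)

lemma level_0: "level m 0 = {x0 m}"
proof -
  have "y = x0 m" if "y \<in> level m 0" for y
  proof -
    have "y \<inter> x0 m = x0 m" using level_cards[OF that] by (simp add: card_subset_eq)
    moreover have "y \<inter> C_set m = {}" using level_cards[OF that] by auto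
    ultimately show ?thesis using level_cards(1)[OF that] S_eq by blast
  qed
  then show ?thesis using x0_level by blast
qed

text \<open>Stepping back through \<open>level_pred\<close> gives a walk of length \<open>p\<close>;
  no walk is shorter because an edge changes the index of the sphere by exactly one.\<close>

lemma gdist_level:
  assumes "y \<in> level m p" "p \<le> 2*m+1"
  shows "gdist m (x0 m) y = p"
proof -
  have path: "(x0 m, y) \<in> edges m ^^ p" using assms
  proof (induction p arbitrary: y)
    case 0 then show ?case using level_0 by simp
  next
    case (Suc p)
    then obtain z where "z \<in> level m p" "adj m z y" using level_pred[of y m p] by auto
    then show ?case using Suc.IH[of z] Suc.prems by (auto simp: edges_def)
  qed
  have low: "p \<le> n" if "(x0 m, y) \<in> edges m ^^ n" for n using that assms
  proof (induction n arbitrary: y p)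
    case 0
    then have "y \<in> level m 0" using x0_level[of m] by simp
    then show ?case using level_unique[OF 0(2), of 0] 0 by auto
  next
    case (Suc n)
    then obtain z where z: "(x0 m, z) \<in> edges m ^^ n" "adj m z y" by (auto simp: edges_def)
    then have "z \<in> X_set m" by (simp add: adj_def)
    then obtain q where q: "q \<le> 2*m+1" "z \<in> level m q" by (rule X_level)
    then have "q \<le> n" using Suc.IH z by blast
    then show ?case using adj_level[OF q(2) Suc.prems(2) q(1) Suc.prems(3) z(2)] by auto
  qed
  show ?thesis unfolding gdist_def by (rule Least_equality) (use path low in auto)
qed

lemma Estar_eq:
  assumes "i \<le> 2*m+1"
  shows "Estar m i = (\<lambda>y z. if y = z \<and> y \<in> level m i then 1 else 0)"
proof (intro ext)
  fix y z
  have "(y \<in> X_set m \<and> gdist m (x0 m) y = i) \<longleftrightarrow> y \<in> level m i"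
    using X_level[of y m] gdist_level level_subset_X[OF assms] assms by (metis subsetD)
  then show "Estar m i y z = (if y = z \<and> y \<in> level m i then 1 else 0)"
    unfolding Estar_def by auto
qed

section \<open>Weight functions\<close>

text \<open>This is the polytabloid-like vector built from \<open>j\<close> disjoint pairs,
  antisymmetric in each of them. Using the same product for subsets of every size yields the
  lowest-weight vector and, up to scalars, all its images under the raising operator at
  once.\<close>

definition pair_sgn :: "nat \<Rightarrow> nat \<Rightarrow> nat set \<Rightarrow> complex" where
  "pair_sgn c j y = (\<Prod>i<j. of_bool (c + 2*i + 1 \<in> y) - of_bool (c + 2*i + 2 \<in> y))"

text \<open>Freezing the points outside one pair reduces the later computations to the four possible
  memberships of that pair.\<close>

lemma pair_sgn_factor:
  assumes "i < j"
  obtains K where "\<And>y'. (\<And>x. x \<noteq> c + 2*i + 1 \<Longrightarrow> x \<noteq> c + 2*i + 2 \<Longrightarrow> x \<in> y' \<longleftrightarrow> x \<in> y) \<Longrightarrow>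
    pair_sgn c j y' = K * (of_bool (c + 2*i + 1 \<in> y') - of_bool (c + 2*i + 2 \<in> y'))"
proof (rule that)
  fix y'
  assume *: "\<And>x. x \<noteq> c + 2*i + 1 \<Longrightarrow> x \<noteq> c + 2*i + 2 \<Longrightarrow> x \<in> y' \<longleftrightarrow> x \<in> y"
  have "(\<Prod>l\<in>{..<j} - {i}. of_bool (c + 2*l + 1 \<in> y') - of_bool (c + 2*l + 2 \<in> y') :: complex)
      = (\<Prod>l\<in>{..<j} - {i}. of_bool (c + 2*l + 1 \<in> y) - of_bool (c + 2*l + 2 \<in> y))"
  proof (rule prod.cong[OF refl])
    fix l assume "l \<in> {..<j} - {i}"
    then have "l \<noteq> i" by simp
    then have "c + 2*l + 1 \<in> y' \<longleftrightarrow> c + 2*l + 1 \<in> y" "c + 2*l + 2 \<in> y' \<longleftrightarrow> c + 2*l + 2 \<in> y"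
      by (intro *; presburger)+
    then show "of_bool (c + 2*l + 1 \<in> y') - of_bool (c + 2*l + 2 \<in> y') =
      (of_bool (c + 2*l + 1 \<in> y) - of_bool (c + 2*l + 2 \<in> y) :: complex)" by simp
  qed
  then show "pair_sgn c j y' = (\<Prod>l\<in>{..<j} - {i}. of_bool (c + 2*l + 1 \<in> y) - of_bool (c + 2*l + 2 \<in> y)) *
    (of_bool (c + 2*i + 1 \<in> y') - of_bool (c + 2*i + 2 \<in> y'))"
    using assms unfolding pair_sgn_def by (subst prod.remove[of _ i]) (auto simp: mult.commute)
qed

lemma pair_sgn_unpaired:
  assumes "x \<le> c \<or> c + 2*j < x"
  shows "pair_sgn c j (insert x y) = pair_sgn c j y" "pair_sgn c j (y - {x}) = pair_sgn c j y"
  unfolding pair_sgn_def by (rule prod.cong; use assms in auto)+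

text \<open>Here \<open>g x\<close> stands for the change of \<open>pair_sgn\<close> caused by
  moving the point \<open>x\<close>. Points outside the pairs cause none, so only the total over
  each pair has to be known.\<close>

lemma sum_pairs:
  fixes g :: "nat \<Rightarrow> complex"
  assumes pair: "\<And>i. i < j \<Longrightarrow> g (c + 2*i + 1) + g (c + 2*i + 2) = - s"
    and rest: "\<And>x. c + 2*j < x \<Longrightarrow> g x = 0" and "2 * j \<le> n"
  shows "sum g {c+1..c+n} = - of_nat j * s"
proof -
  have *: "sum g {c+1..c+2*l} = - of_nat l * s" if "l \<le> j" for l using that
  proof (induction l)
    case (Suc l)
    have "{c+1..c+2*Suc l} = insert (c+2*l+1) (insert (c+2*l+2) {c+1..c+2*l})" by auto
    then have "sum g {c+1..c+2*Suc l} = g (c+2*l+1) + g (c+2*l+2) + sum g {c+1..c+2*l}"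
      by (simp add: add.assoc)
    then show ?case using Suc pair[of l] by (simp add: algebra_simps)
  qed simp
  have "{c+1..c+n} = {c+1..c+2*j} \<union> {c+2*j+1..c+n}" using assms(3) by auto
  then have "sum g {c+1..c+n} = sum g {c+1..c+2*j} + sum g {c+2*j+1..c+n}"
    by (simp add: sum.union_disjoint)
  moreover have "sum g {c+2*j+1..c+n} = 0" by (rule sum.neutral) (use rest in auto)
  ultimately show ?thesis using *[of j] by simp
qed

text \<open>Every pair lowers the sum by one copy of the value \<open>s\<close> at \<open>y\<close>.
  If \<open>y\<close> contains one point of the pair, inserting the other kills the factor, a change
  of \<open>- s\<close>. If it contains neither, \<open>s\<close> is 0 and the two insertions
  cancel. If it contains both, \<open>s\<close> is 0 and nothing can be inserted.\<close>

lemma sum_pair_sgn_insert: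
  assumes "2 * j \<le> n"
  shows "(\<Sum>x\<in>{c+1..c+n} - y. pair_sgn c j (insert x y)) =
    (of_nat (card ({c+1..c+n} - y)) - of_nat j) * pair_sgn c j y"
proof -
  let ?s = "pair_sgn c j y" and ?Z = "{c+1..c+n}"
  let ?g = "\<lambda>x. if x \<in> y then 0 else pair_sgn c j (insert x y) - ?s"
  have "sum ?g ?Z = - of_nat j * ?s"
  proof (rule sum_pairs[OF _ _ assms])
    fix i assume "i < j"
    from pair_sgn_factor[OF this, of c y] obtain K where
      "\<And>y'. (\<And>x. x \<noteq> c + 2*i + 1 \<Longrightarrow> x \<noteq> c + 2*i + 2 \<Longrightarrow> x \<in> y' \<longleftrightarrow> x \<in> y) \<Longrightarrow>
        pair_sgn c j y' = K * (of_bool (c + 2*i + 1 \<in> y') - of_bool (c + 2*i + 2 \<in> y'))" by metis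
    from this[of y] this[of "insert (c+2*i+1) y"] this[of "insert (c+2*i+2) y"]
    show "?g (c + 2*i + 1) + ?g (c + 2*i + 2) = - ?s" by (auto simp: of_bool_def)
  qed (auto simp: pair_sgn_unpaired)
  moreover have "sum ?g ?Z = (\<Sum>x\<in>?Z - y. pair_sgn c j (insert x y) - ?s)"
    by (rule sum.mono_neutral_cong_right) auto
  ultimately show ?thesis by (simp add: sum_subtractf algebra_simps)
qed

lemma sum_pair_sgn_remove:
  assumes "2 * j \<le> n"
  shows "(\<Sum>x\<in>y \<inter> {c+1..c+n}. pair_sgn c j (y - {x})) =
    (of_nat (card (y \<inter> {c+1..c+n})) - of_nat j) * pair_sgn c j y"
proof -
  let ?s = "pair_sgn c j y" and ?Z = "{c+1..c+n}"
  let ?g = "\<lambda>x. if x \<in> y then pair_sgn c j (y - {x}) - ?s else 0"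
  have "sum ?g ?Z = - of_nat j * ?s"
  proof (rule sum_pairs[OF _ _ assms])
    fix i assume "i < j"
    from pair_sgn_factor[OF this, of c y] obtain K where
      "\<And>y'. (\<And>x. x \<noteq> c + 2*i + 1 \<Longrightarrow> x \<noteq> c + 2*i + 2 \<Longrightarrow> x \<in> y' \<longleftrightarrow> x \<in> y) \<Longrightarrow>
        pair_sgn c j y' = K * (of_bool (c + 2*i + 1 \<in> y') - of_bool (c + 2*i + 2 \<in> y'))" by metis
    from this[of y] this[of "y - {c+2*i+1}"] this[of "y - {c+2*i+2}"]
    show "?g (c + 2*i + 1) + ?g (c + 2*i + 2) = - ?s" by (auto simp: of_bool_def)
  qed (auto simp: pair_sgn_unpaired)
  moreover have "sum ?g ?Z = (\<Sum>x\<in>y \<inter> ?Z. pair_sgn c j (y - {x}) - ?s)"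
    by (rule sum.mono_neutral_cong_right) auto
  ultimately show ?thesis by (simp add: sum_subtractf algebra_simps)
qed

definition chi :: "nat \<Rightarrow> nat \<Rightarrow> nat \<Rightarrow> nat set \<Rightarrow> complex" where
  "chi m j k y = pair_sgn 0 j y * pair_sgn m k y"

text \<open>The spheres on which \<open>\<chi>\<^sub>j\<^sub>k\<close> does not vanish identically.\<close>

definition feasible :: "nat \<Rightarrow> nat \<Rightarrow> nat \<Rightarrow> nat \<Rightarrow> bool" where
  "feasible m j k p \<longleftrightarrow> j \<le> p div 2 \<and> p div 2 + j \<le> m \<and> k \<le> (p + 1) div 2 \<and> (p + 1) div 2 + k \<le> m + 1"

lemma feasible_bounds:
  assumes "feasible m j k p"
  shows "2 * j \<le> m" "2 * k \<le> m + 1" "p \<le> 2 * m + 1"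
proof -
  have "n = n div 2 + (n + 1) div 2" for n :: nat by presburger
  from this[of p] assms show "2 * j \<le> m" "2 * k \<le> m + 1" "p \<le> 2 * m + 1"
    unfolding feasible_def by linarith+
qed

lemma x0_eq: "x0 m = {0+1..0+m}" and C_eq: "C_set m = {m+1..m+(m+1)}"
  by (auto simp: x0_def C_set_def)

text \<open>Each entry is the number of moves available from sphere \<open>p\<close> to sphere
  \<open>q\<close>, minus the weight (\<open>j\<close> or \<open>k\<close>) of the lattice in which
  these moves take place.\<close>

definition hop :: "nat \<Rightarrow> nat \<Rightarrow> nat \<Rightarrow> nat \<Rightarrow> nat \<Rightarrow> complex" where
  "hop m j k p q =
    (if q = Suc p then
       (if even p then of_nat (m + 1) - of_nat ((p + 1) div 2) - of_nat k else of_nat m - of_nat (p div 2) - of_nat j)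
     else if p = Suc q then
       (if even p then of_nat (p div 2) - of_nat j else of_nat ((p + 1) div 2) - of_nat k)
     else 0)"

context
  fixes m j k :: nat
  assumes j: "2 * j \<le> m" and k: "2 * k \<le> m + 1"
begin

lemma chi_insert_C:
  assumes "x \<in> C_set m"
  shows "chi m j k (insert x y) = pair_sgn 0 j y * pair_sgn m k (insert x y)"
    "chi m j k (y - {x}) = pair_sgn 0 j y * pair_sgn m k (y - {x})"
  using assms j unfolding chi_def C_set_def by (auto simp: pair_sgn_unpaired)

lemma chi_insert_x0:
  assumes "x \<in> x0 m"
  shows "chi m j k (insert x y) = pair_sgn 0 j (insert x y) * pair_sgn m k y"
    "chi m j k (y - {x}) = pair_sgn 0 j (y - {x}) * pair_sgn m k y"
  using assms unfolding chi_def x0_def by (auto simp: pair_sgn_unpaired)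

lemma sum_chi_insert_C:
  "(\<Sum>x\<in>C_set m - y. chi m j k (insert x y)) = (of_nat (card (C_set m - y)) - of_nat k) * chi m j k y"
proof -
  have "(\<Sum>x\<in>C_set m - y. chi m j k (insert x y)) =
    pair_sgn 0 j y * (\<Sum>x\<in>C_set m - y. pair_sgn m k (insert x y))"
    unfolding sum_distrib_left by (rule sum.cong) (auto simp: chi_insert_C)
  then show ?thesis unfolding C_eq sum_pair_sgn_insert[OF k] by (simp add: chi_def mult_ac)
qed

lemma sum_chi_remove_C:
  "(\<Sum>x\<in>y \<inter> C_set m. chi m j k (y - {x})) = (of_nat (card (y \<inter> C_set m)) - of_nat k) * chi m j k y"
proof -
  have "(\<Sum>x\<in>y \<inter> C_set m. chi m j k (y - {x})) =
    pair_sgn 0 j y * (\<Sum>x\<in>y \<inter> C_set m. pair_sgn m k (y - {x}))"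
    unfolding sum_distrib_left by (rule sum.cong) (auto simp: chi_insert_C)
  then show ?thesis unfolding C_eq sum_pair_sgn_remove[OF k] by (simp add: chi_def mult_ac)
qed

lemma sum_chi_insert_x0:
  "(\<Sum>x\<in>x0 m - y. chi m j k (insert x y)) = (of_nat (card (x0 m - y)) - of_nat j) * chi m j k y"
proof -
  have "(\<Sum>x\<in>x0 m - y. chi m j k (insert x y)) =
    (\<Sum>x\<in>x0 m - y. pair_sgn 0 j (insert x y)) * pair_sgn m k y"
    unfolding sum_distrib_right by (rule sum.cong) (auto simp: chi_insert_x0)
  then show ?thesis unfolding x0_eq sum_pair_sgn_insert[OF j] by (simp add: chi_def mult_ac)
qed

lemma sum_chi_remove_x0:
  "(\<Sum>x\<in>y \<inter> x0 m. chi m j k (y - {x})) = (of_nat (card (y \<inter> x0 m)) - of_nat j) * chi m j k y"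
proof -
  have "(\<Sum>x\<in>y \<inter> x0 m. chi m j k (y - {x})) =
    (\<Sum>x\<in>y \<inter> x0 m. pair_sgn 0 j (y - {x})) * pair_sgn m k y"
    unfolding sum_distrib_right by (rule sum.cong) (auto simp: chi_insert_x0)
  then show ?thesis unfolding x0_eq sum_pair_sgn_remove[OF j] by (simp add: chi_def mult_ac)
qed

text \<open>All edges from sphere \<open>p\<close> to sphere \<open>q\<close> move one point in the
  same lattice and the same direction. The other factor of \<open>chi\<close> is then constant, and
  the eigenvalue comes from the sum formula for a single lattice.\<close>

lemma A1_chi:
  assumes y: "y \<in> level m p" and p: "p \<le> 2*m+1" and q: "q \<le> 2*m+1"
  shows "(\<Sum>z\<in>level m q. A1 m y z * chi m j k z) = hop m j k p q * chi m j k y"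
proof -
  have *: "(\<Sum>z\<in>level m q. A1 m y z * chi m j k z) = (\<Sum>z | z \<in> level m q \<and> adj m y z. chi m j k z)"
    unfolding A1_def by (rule sum.mono_neutral_cong_right) auto
  note c = level_cards[OF y]
  have dC: "card (C_set m - y) = m + 1 - (p + 1) div 2"
    using card_Diff_subset_Int[of "C_set m" y] c by (simp add: Int_commute)
  have dx: "card (x0 m - y) = p div 2"
    using card_Diff_subset_Int[of "x0 m" y] c p by (simp add: Int_commute)
  have ins: "inj_on (\<lambda>x. insert x y) (Z - y)" and rem: "inj_on (\<lambda>x. y - {x}) (y \<inter> Z)" for Z
    by (auto simp: inj_on_def)
  consider "q = Suc p" "even p" | "q = Suc p" "odd p" | "p = Suc q" "even p" | "p = Suc q" "odd p"
    | "q \<noteq> Suc p" "p \<noteq> Suc q" by blast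
  then show ?thesis
  proof cases
    case 1
    then have "(p + 1) div 2 \<le> m + 1" using p by simp
    then show ?thesis unfolding * using nbrs_even_up[OF y 1(2) p] 1
      by (simp add: sum.reindex[OF ins] sum_chi_insert_C dC hop_def of_nat_diff)
  next
    case 2
    then have "p \<le> 2*m" "p div 2 \<le> m" using q by auto
    then show ?thesis unfolding * using nbrs_odd_up[OF y 2(2)] 2 c(3)
      by (simp add: sum.reindex[OF rem] sum_chi_remove_x0 hop_def of_nat_diff)
  next
    case 3
    then have "q \<le> 2*m" "odd q" using p by auto
    then show ?thesis unfolding * using nbrs_even_down[OF y[unfolded 3(1)]] 3(1)
      by (simp add: sum.reindex[OF ins] sum_chi_insert_x0 dx hop_def)
  next
    case 4
    then have "q \<le> 2*m" "even q" using p by auto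
    then show ?thesis unfolding * using nbrs_odd_down[OF y[unfolded 4(1)]] 4(1) c(4)
      by (simp add: sum.reindex[OF rem] sum_chi_remove_C hop_def)
  next
    case 5
    then have "{z. z \<in> level m q \<and> adj m y z} = {}" using adj_level[OF y _ p q] by blast
    from 5 show ?thesis unfolding * \<open>{z. z \<in> level m q \<and> adj m y z} = {}\<close> by (simp add: hop_def)
  qed
qed

end

section \<open>Supports of the weight functions\<close>

lemma pair_sgn_eq_0:
  assumes "i < j" "c + 2*i + 1 \<in> y \<longleftrightarrow> c + 2*i + 2 \<in> y"
  shows "pair_sgn c j y = 0"
  unfolding pair_sgn_def using assms by (intro prod_zero) (auto intro!: bexI[of _ i])

lemma pair_sgn_nonzero_card:
  assumes "pair_sgn c j y \<noteq> 0" "finite y" "2 * j \<le> n"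
  shows "j \<le> card (y \<inter> {c+1..c+n})" "card (y \<inter> {c+1..c+n}) + j \<le> n"
proof -
  have one: "c + 2*i + 1 \<in> y \<longleftrightarrow> c + 2*i + 2 \<notin> y" if "i < j" for i
    using pair_sgn_eq_0[OF that] assms(1) by metis
  \<comment> \<open>A nonzero product means that \<open>y\<close> splits every pair;
    \<open>f\<close> chooses the point inside \<open>y\<close> and \<open>g\<close> the point
    outside. Each is injective because \<open>(x - c - 1) div 2\<close> recovers the index of the
    pair.\<close>
  define f where "f i = (if c + 2*i + 1 \<in> y then c + 2*i + 1 else c + 2*i + 2)" for i
  define g where "g i = (if c + 2*i + 1 \<in> y then c + 2*i + 2 else c + 2*i + 1)" for i
  have inj: "inj_on f {..<j}" "inj_on g {..<j}"
    by (rule inj_on_inverseI[where g = "\<lambda>x. (x - c - 1) div 2"]; simp add: f_def g_def)+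
  have f: "f ` {..<j} \<subseteq> y \<inter> {c+1..c+n}" and g: "g ` {..<j} \<subseteq> {c+1..c+n} - y"
    using one assms(3) by (auto simp: f_def g_def)
  show "j \<le> card (y \<inter> {c+1..c+n})"
    using card_mono[OF _ f] card_image[OF inj(1)] by simp
  have "j \<le> card ({c+1..c+n} - y)"
    using card_mono[OF _ g] card_image[OF inj(2)] by simp
  also have "\<dots> = n - card (y \<inter> {c+1..c+n})"
    by (subst card_Diff_subset_Int) (auto simp: Int_commute)
  finally show "card (y \<inter> {c+1..c+n}) + j \<le> n"
    using card_mono[of "{c+1..c+n}" "y \<inter> {c+1..c+n}"] by simp
qed

lemma pair_sgn_nonzero_ex:
  assumes "j \<le> a" "a + j \<le> n"
  obtains y where "y \<subseteq> {c+1..c+n}" "card y = a" "pair_sgn c j y = 1"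
proof -
  \<comment> \<open>The witness consists of the first point of every pair, making each factor 1, and
    of \<open>a - j\<close> filler points beyond all the pairs.\<close>
  have "a - j \<le> card {c+2*j+1..c+n}" using assms by simp
  then obtain t where t: "t \<subseteq> {c+2*j+1..c+n}" "card t = a - j" "finite t"
    by (rule obtain_subset_with_card_n)
  define s where "s = (\<lambda>i. c + 2*i + 1) ` {..<j}"
  have inj: "inj_on (\<lambda>i. c + 2*i + 1) {..<j}" by (auto simp: inj_on_def)
  have s: "card s = j" "finite s" unfolding s_def using card_image[OF inj] by auto
  show thesis
  proof (rule that[of "s \<union> t"])
    show "s \<union> t \<subseteq> {c+1..c+n}" using t assms by (fastforce simp: s_def)
    have "s \<inter> t = {}" using t by (fastforce simp: s_def)
    then show "card (s \<union> t) = a" using s t assms by (simp add: card_Un_disjoint)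
    have "c + 2*i + 1 \<in> s \<union> t \<and> c + 2*i + 2 \<notin> s \<union> t" if "i < j" for i
    proof
      show "c + 2*i + 1 \<in> s \<union> t" using that by (simp add: s_def)
      have "c + 2*i + 2 \<noteq> c + 2*l + 1" for l by presburger
      then have "c + 2*i + 2 \<notin> s" unfolding s_def by blast
      moreover have "c + 2*i + 2 \<notin> {c+2*j+1..c+n}" using that by simp
      then have "c + 2*i + 2 \<notin> t" using t(1) by blast
      ultimately show "c + 2*i + 2 \<notin> s \<union> t" by simp
    qed
    then show "pair_sgn c j (s \<union> t) = 1" unfolding pair_sgn_def by simp
  qed
qed

lemma chi_feasible:
  assumes "y \<in> level m p" "p \<le> 2*m+1" "chi m j k y \<noteq> 0" "2 * j \<le> m" "2 * k \<le> m + 1"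
  shows "feasible m j k p"
proof -
  have nz: "pair_sgn 0 j y \<noteq> 0" "pair_sgn m k y \<noteq> 0" using assms(3) by (auto simp: chi_def)
  note c = level_cards[OF assms(1)]
  have "p div 2 \<le> m" using assms(2) by simp
  then show ?thesis unfolding feasible_def
    using pair_sgn_nonzero_card[OF nz(1) c(2) assms(4)] pair_sgn_nonzero_card[OF nz(2) c(2) assms(5)] c(3,4)
    unfolding x0_eq[symmetric] C_eq[symmetric] by linarith
qed

lemma pair_sgn_cong:
  assumes "y \<inter> {c+1..c+n} = y' \<inter> {c+1..c+n}" "2 * j \<le> n"
  shows "pair_sgn c j y = pair_sgn c j y'"
proof -
  have "x \<in> y \<longleftrightarrow> x \<in> y'" if "x \<in> {c+1..c+n}" for x using assms(1) that by blast
  then show ?thesis unfolding pair_sgn_def using assms(2) by (intro prod.cong) auto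
qed

lemma feasible_chi:
  assumes "feasible m j k p"
  obtains y where "y \<in> level m p" "chi m j k y \<noteq> 0"
proof -
  note f = assms[unfolded feasible_def] and b = feasible_bounds[OF assms]
  obtain u where u: "u \<subseteq> x0 m" "card u = m - p div 2" "pair_sgn 0 j u = 1"
  proof (rule pair_sgn_nonzero_ex[of j "m - p div 2" m 0])
    show "j \<le> m - p div 2" "m - p div 2 + j \<le> m" using f by linarith+
  qed (use that in \<open>simp add: x0_def\<close>)
  obtain v where v: "v \<subseteq> C_set m" "card v = (p + 1) div 2" "pair_sgn m k v = 1"
    using pair_sgn_nonzero_ex[of k "(p + 1) div 2" "m+1" m] f unfolding C_eq by metis
  have uv: "(u \<union> v) \<inter> x0 m = u" "(u \<union> v) \<inter> C_set m = v" "u \<inter> x0 m = u" "v \<inter> C_set m = v"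
    using u(1) v(1) x0_C_disj by blast+
  have "u \<union> v \<in> level m p" using uv u v S_eq by (auto simp: level_def)
  moreover have "pair_sgn 0 j (u \<union> v) = 1"
    using pair_sgn_cong[of "u \<union> v" 0 m u j] uv u(3) b(1) unfolding x0_eq by simp
  moreover have "pair_sgn m k (u \<union> v) = 1"
    using pair_sgn_cong[of "u \<union> v" m "m+1" v k] uv v(3) b(2) unfolding C_eq by simp
  ultimately show thesis using that[of "u \<union> v"] by (simp add: chi_def)
qed

section \<open>The action on weight functions\<close>

text \<open>For \<open>M\<close> in \<open>T\<close> the array \<open>c\<close> is the matrix of \<open>M\<close> on the module generated by \<open>\<chi>\<^sub>j\<^sub>k\<close>; entries outside the
  feasible range are arbitrary, and \<open>coef\<close> below sets them to 0.\<close>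

definition acts :: "nat \<Rightarrow> xmat \<Rightarrow> nat \<Rightarrow> nat \<Rightarrow> (nat \<Rightarrow> nat \<Rightarrow> complex) \<Rightarrow> bool" where
  "acts m M j k c \<longleftrightarrow> (\<forall>p\<le>2*m+1. \<forall>q\<le>2*m+1. \<forall>y\<in>level m p.
     (\<Sum>z\<in>level m q. M y z * chi m j k z) = c p q * chi m j k y)"

definition coef :: "nat \<Rightarrow> xmat \<Rightarrow> nat \<times> nat \<times> nat \<times> nat \<Rightarrow> complex" where
  "coef m M = (\<lambda>(j, k, p, q). if feasible m j k p \<and> feasible m j k q
     then (SOME c. acts m M j k c) p q else 0)"

lemma actsD:
  assumes "acts m M j k c" "p \<le> 2*m+1" "q \<le> 2*m+1" "y \<in> level m p"
  shows "(\<Sum>z\<in>level m q. M y z * chi m j k z) = c p q * chi m j k y"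
  using assms unfolding acts_def by blast

text \<open>On a feasible sphere \<open>chi\<close> has a nonzero value that can be cancelled. Hence
  the choice made by \<open>SOME\<close> in \<open>coef\<close> does not matter.\<close>

lemma acts_unique:
  assumes "acts m M j k c" "acts m M j k c'" "feasible m j k p" "feasible m j k q"
  shows "c p q = c' p q"
proof -
  obtain y where y: "y \<in> level m p" "chi m j k y \<noteq> 0" using feasible_chi[OF assms(3)] .
  have "p \<le> 2*m+1" "q \<le> 2*m+1" using feasible_bounds assms(3,4) by auto
  then have "c p q * chi m j k y = c' p q * chi m j k y"
    using actsD[OF assms(1) _ _ y(1)] actsD[OF assms(2) _ _ y(1)] by metis
  then show ?thesis using y(2) by simp
qed

lemma coef_eq:
  assumes "acts m M j k c" "feasible m j k p" "feasible m j k q"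
  shows "coef m M (j, k, p, q) = c p q"
  using acts_unique[OF someI[of "acts m M j k", OF assms(1)] assms] assms(2,3)
  by (simp add: coef_def)

lemma coef_eq_0: "\<not> (feasible m j k p \<and> feasible m j k q) \<Longrightarrow> coef m M (j, k, p, q) = 0"
  by (auto simp: coef_def)

text \<open>Replacing the infeasible entries by 0 is harmless: \<open>chi\<close> vanishes on the
  whole sphere of the row or on the whole sphere of the column, so both sides are 0.\<close>

lemma acts_coef:
  assumes "acts m M j k c" "2 * j \<le> m" "2 * k \<le> m + 1"
  shows "acts m M j k (\<lambda>p q. coef m M (j, k, p, q))"
  unfolding acts_def
proof (intro allI ballI impI)
  fix p q y assume *: "p \<le> 2*m+1" "q \<le> 2*m+1" "y \<in> level m p"
  show "(\<Sum>z\<in>level m q. M y z * chi m j k z) = coef m M (j, k, p, q) * chi m j k y"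
  proof (cases "feasible m j k p \<and> feasible m j k q")
    case True
    then show ?thesis using coef_eq[OF assms(1)] actsD[OF assms(1) *] by simp
  next
    case False
    have "(\<Sum>z\<in>level m q. M y z * chi m j k z) = 0"
    proof (cases "feasible m j k q")
      case True
      then have "chi m j k y = 0" using chi_feasible[OF *(3,1) _ assms(2,3)] False by blast
      then show ?thesis using actsD[OF assms(1) *] by simp
    next
      case False
      then show ?thesis using chi_feasible[OF _ *(2) _ assms(2,3)] by (intro sum.neutral) auto
    qed
    then show ?thesis using coef_eq_0[OF False] by simp
  qed
qed

lemma acts_add:
  assumes "acts m M j k c" "acts m N j k d"
  shows "acts m (xadd M N) j k (\<lambda>p q. c p q + d p q)"
  using actsD[OF assms(1)] actsD[OF assms(2)] unfolding acts_def xadd_def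
  by (simp add: distrib_right sum.distrib)

lemma acts_smult:
  assumes "acts m M j k c"
  shows "acts m (xsmult a M) j k (\<lambda>p q. a * c p q)"
  using actsD[OF assms(1)] unfolding acts_def xsmult_def
  by (simp add: mult.assoc sum_distrib_left[symmetric])

lemma acts_mult:
  assumes "acts m M j k c" "acts m N j k d"
  shows "acts m (xmult m M N) j k (\<lambda>p q. \<Sum>r\<le>2*m+1. c p r * d r q)"
  unfolding acts_def
proof (intro allI ballI impI)
  fix p q y assume *: "p \<le> 2*m+1" "q \<le> 2*m+1" "y \<in> level m p"
  have "(\<Sum>z\<in>level m q. xmult m M N y z * chi m j k z) =
      (\<Sum>w\<in>X_set m. M y w * (\<Sum>z\<in>level m q. N w z * chi m j k z))"
    unfolding xmult_def sum_distrib_left sum_distrib_right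
    by (subst sum.swap) (simp add: mult.assoc)
  also have "\<dots> = (\<Sum>r\<le>2*m+1. \<Sum>w\<in>level m r. M y w * (d r q * chi m j k w))"
    unfolding sum_X_levels using actsD[OF assms(2) _ *(2)] by (intro sum.cong refl) auto
  also have "\<dots> = (\<Sum>r\<le>2*m+1. d r q * (\<Sum>w\<in>level m r. M y w * chi m j k w))"
    unfolding sum_distrib_left by (simp only: mult.left_commute)
  also have "\<dots> = (\<Sum>r\<le>2*m+1. d r q * (c p r * chi m j k y))"
    using actsD[OF assms(1) *(1) _ *(3)] by (intro sum.cong refl) auto
  also have "\<dots> = (\<Sum>r\<le>2*m+1. c p r * d r q) * chi m j k y"
    unfolding sum_distrib_right by (simp only: mult_ac)
  finally show "(\<Sum>z\<in>level m q. xmult m M N y z * chi m j k z) =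
    (\<Sum>r\<le>2*m+1. c p r * d r q) * chi m j k y" .
qed

lemma acts_A1: "2 * j \<le> m \<Longrightarrow> 2 * k \<le> m + 1 \<Longrightarrow> acts m (A1 m) j k (hop m j k)"
  unfolding acts_def using A1_chi by blast

lemma acts_Estar:
  assumes "i \<le> 2*m+1"
  shows "acts m (Estar m i) j k (\<lambda>p q. if p = i \<and> q = i then 1 else 0)"
  unfolding acts_def
proof (intro allI ballI impI)
  fix p q y assume *: "p \<le> 2*m+1" "q \<le> 2*m+1" "y \<in> level m p"
  have "(\<Sum>z\<in>level m q. Estar m i y z * chi m j k z)
      = (\<Sum>z\<in>level m q. if y = z then (if y \<in> level m i then chi m j k z else 0) else 0)"
    unfolding Estar_eq[OF assms] by (intro sum.cong) auto
  also have "\<dots> = (if y \<in> level m q \<and> y \<in> level m i then chi m j k y else 0)"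
    by (simp add: sum.delta)
  also have "\<dots> = (if p = i \<and> q = i then 1 else 0) * chi m j k y"
    using level_unique[OF *(3) _ *(1) *(2)] level_unique[OF *(3) _ *(1) assms] *(3) by auto
  finally show "(\<Sum>z\<in>level m q. Estar m i y z * chi m j k z) =
    (if p = i \<and> q = i then 1 else 0) * chi m j k y" .
qed

lemma Terwilliger_acts:
  assumes "M \<in> Terwilliger m" "2 * j \<le> m" "2 * k \<le> m + 1"
  shows "\<exists>c. acts m M j k c"
  using assms(1)
proof induction
  case gen_A then show ?case using acts_A1[OF assms(2,3)] by blast
next
  case gen_E then show ?case using acts_Estar by blast
next
  case add then show ?case using acts_add by blast
next
  case smult then show ?case using acts_smult by blast
next
  case mult then show ?case using acts_mult by blast
qed

lemma Terwilliger_acts_coef: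
  assumes "M \<in> Terwilliger m" "2 * j \<le> m" "2 * k \<le> m + 1"
  shows "acts m M j k (\<lambda>p q. coef m M (j, k, p, q))"
  using Terwilliger_acts[OF assms] acts_coef[OF _ assms(2,3)] by blast

lemma coef_xadd:
  assumes "M \<in> Terwilliger m" "N \<in> Terwilliger m"
  shows "coef m (xadd M N) = (\<lambda>x. coef m M x + coef m N x)"
proof (rule ext, clarify)
  fix j k p q
  show "coef m (xadd M N) (j, k, p, q) = coef m M (j, k, p, q) + coef m N (j, k, p, q)"
  proof (cases "feasible m j k p \<and> feasible m j k q")
    case True
    then show ?thesis using coef_eq[OF acts_add[OF Terwilliger_acts_coef[OF assms(1)] Terwilliger_acts_coef[OF assms(2)]]]
        feasible_bounds(1,2) by blast
  qed (simp add: coef_eq_0)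
qed

lemma coef_xsmult:
  assumes "M \<in> Terwilliger m"
  shows "coef m (xsmult a M) = (\<lambda>x. a * coef m M x)"
proof (rule ext, clarify)
  fix j k p q
  show "coef m (xsmult a M) (j, k, p, q) = a * coef m M (j, k, p, q)"
  proof (cases "feasible m j k p \<and> feasible m j k q")
    case True
    then show ?thesis using coef_eq[OF acts_smult[OF Terwilliger_acts_coef[OF assms]]]
        feasible_bounds(1,2) by blast
  qed (simp add: coef_eq_0)
qed

definition cmul :: "nat \<Rightarrow> (nat \<times> nat \<times> nat \<times> nat \<Rightarrow> complex) \<Rightarrow> (nat \<times> nat \<times> nat \<times> nat \<Rightarrow> complex) \<Rightarrow>
    nat \<times> nat \<times> nat \<times> nat \<Rightarrow> complex" where
  "cmul m f g = (\<lambda>(j, k, p, q). \<Sum>r\<le>2*m+1. f (j, k, p, r) * g (j, k, r, q))"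

lemma coef_xmult:
  assumes "M \<in> Terwilliger m" "N \<in> Terwilliger m"
  shows "coef m (xmult m M N) = cmul m (coef m M) (coef m N)"
proof (rule ext, clarify)
  fix j k p q
  show "coef m (xmult m M N) (j, k, p, q) = cmul m (coef m M) (coef m N) (j, k, p, q)"
  proof (cases "feasible m j k p \<and> feasible m j k q")
    case True
    then have "2 * j \<le> m" "2 * k \<le> m + 1" using feasible_bounds(1,2) by blast+
    then show ?thesis unfolding cmul_def
      using True coef_eq[OF acts_mult[OF Terwilliger_acts_coef[OF assms(1)] Terwilliger_acts_coef[OF assms(2)]]]
      by simp
  next
    case False
    then show ?thesis by (auto simp: coef_eq_0 cmul_def)
  qed
qed

section \<open>The image of the algebra: producing all matrix units\<close>

definition coefs :: "nat \<Rightarrow> (nat \<times> nat \<times> nat \<times> nat \<Rightarrow> complex) set" where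
  "coefs m = coef m ` Terwilliger m"

lemma coefs_add: "f \<in> coefs m \<Longrightarrow> g \<in> coefs m \<Longrightarrow> (\<lambda>x. f x + g x) \<in> coefs m"
  unfolding coefs_def by (auto simp: coef_xadd[symmetric] intro!: imageI Terwilliger.add)

lemma coefs_smult: "f \<in> coefs m \<Longrightarrow> (\<lambda>x. a * f x) \<in> coefs m"
  unfolding coefs_def by (auto simp: coef_xsmult[symmetric] intro!: imageI Terwilliger.smult)

lemma coefs_cmul: "f \<in> coefs m \<Longrightarrow> g \<in> coefs m \<Longrightarrow> cmul m f g \<in> coefs m"
  unfolding coefs_def by (auto simp: coef_xmult[symmetric] intro!: imageI Terwilliger.mult)

text \<open>This is the slice belonging to one ordered pair of spheres, the shape of an image of
  \<open>Estar m p\<close> times \<open>T\<close> times \<open>Estar m q\<close>. Such an element is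
  described by one scalar for each module meeting both spheres.\<close>

definition blk :: "nat \<Rightarrow> nat \<Rightarrow> nat \<Rightarrow> (nat \<times> nat \<Rightarrow> complex) \<Rightarrow> nat \<times> nat \<times> nat \<times> nat \<Rightarrow> complex" where
  "blk m p q f = (\<lambda>(j, k, p', q'). if p' = p \<and> q' = q \<and> feasible m j k p \<and> feasible m j k q then f (j, k) else 0)"

lemma blk_cong:
  assumes "\<And>j k. feasible m j k p \<Longrightarrow> feasible m j k q \<Longrightarrow> f (j, k) = g (j, k)"
  shows "blk m p q f = blk m p q g"
  using assms by (auto simp: blk_def fun_eq_iff)

text \<open>A module that misses the intermediate sphere \<open>r\<close> has no component through
  which the product could pass, hence the conditional.\<close>

lemma cmul_blk:
  assumes "r \<le> 2*m+1"
  shows "cmul m (blk m p r f) (blk m r q g) =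
    blk m p q (\<lambda>(j, k). if feasible m j k r then f (j, k) * g (j, k) else 0)"
proof (rule ext, clarify)
  fix j k p' q'
  have "cmul m (blk m p r f) (blk m r q g) (j, k, p', q') =
    (\<Sum>s\<le>2*m+1. if s = r then blk m p r f (j, k, p', r) * blk m r q g (j, k, r, q') else 0)"
    unfolding cmul_def prod.case by (rule sum.cong) (auto simp: blk_def)
  also have "\<dots> = blk m p r f (j, k, p', r) * blk m r q g (j, k, r, q')"
    using assms by (simp add: sum.delta)
  also have "\<dots> = blk m p q (\<lambda>(j, k). if feasible m j k r then f (j, k) * g (j, k) else 0) (j, k, p', q')"
    by (simp add: blk_def)
  finally show "cmul m (blk m p r f) (blk m r q g) (j, k, p', q') =
    blk m p q (\<lambda>(j, k). if feasible m j k r then f (j, k) * g (j, k) else 0) (j, k, p', q')" .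
qed

lemma blk_mult_mem:
  assumes "blk m p r f \<in> coefs m" "blk m r q g \<in> coefs m" "r \<le> 2*m+1"
  shows "blk m p q (\<lambda>(j, k). if feasible m j k r then f (j, k) * g (j, k) else 0) \<in> coefs m"
  using coefs_cmul[OF assms(1,2)] cmul_blk[OF assms(3)] by metis

lemma blk_add_mem:
  assumes "blk m p q f \<in> coefs m" "blk m p q g \<in> coefs m"
  shows "blk m p q (\<lambda>b. f b + g b) \<in> coefs m"
proof -
  have "blk m p q (\<lambda>b. f b + g b) = (\<lambda>x. blk m p q f x + blk m p q g x)"
    by (auto simp: blk_def fun_eq_iff)
  then show ?thesis using coefs_add[OF assms] by simp
qed

lemma blk_smult_mem:
  assumes "blk m p q f \<in> coefs m"
  shows "blk m p q (\<lambda>b. a * f b) \<in> coefs m"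
proof -
  have "blk m p q (\<lambda>b. a * f b) = (\<lambda>x. a * blk m p q f x)"
    by (auto simp: blk_def fun_eq_iff)
  then show ?thesis using coefs_smult[OF assms] by simp
qed

lemma blk_1_mem:
  assumes "p \<le> 2*m+1"
  shows "blk m p p (\<lambda>_. 1) \<in> coefs m"
proof -
  have "coef m (Estar m p) = blk m p p (\<lambda>_. 1)"
  proof (rule ext, clarify)
    fix j k p' q'
    show "coef m (Estar m p) (j, k, p', q') = blk m p p (\<lambda>_. 1) (j, k, p', q')"
    proof (cases "feasible m j k p' \<and> feasible m j k q'")
      case True
      then show ?thesis using coef_eq[OF acts_Estar[OF assms], of j k p' q'] by (auto simp: blk_def)
    next
      case False
      then show ?thesis using coef_eq_0[OF False] by (auto simp: blk_def)
    qed
  qed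
  then show ?thesis using Terwilliger.gen_E[OF assms] unfolding coefs_def by (metis imageI)
qed

text \<open>The slice is cut out by multiplying with \<open>Estar m p\<close> on the left and
  \<open>Estar m q\<close> on the right.\<close>

lemma blk_of_mem:
  assumes "f \<in> coefs m" "p \<le> 2*m+1" "q \<le> 2*m+1"
  shows "blk m p q (\<lambda>(j, k). f (j, k, p, q)) \<in> coefs m"
proof -
  have "cmul m (cmul m (blk m p p (\<lambda>_. 1)) f) (blk m q q (\<lambda>_. 1)) = blk m p q (\<lambda>(j, k). f (j, k, p, q))"
  proof (rule ext, clarify)
    fix j k p' q'
    have 1: "cmul m (blk m p p (\<lambda>_. 1)) f (j, k, p', s) = (if p' = p \<and> feasible m j k p then f (j, k, p, s) else 0)" for s
    proof -
      have "cmul m (blk m p p (\<lambda>_. 1)) f (j, k, p', s) =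
        (\<Sum>r\<le>2*m+1. if r = p then (if p' = p \<and> feasible m j k p then f (j, k, p, s) else 0) else 0)"
        unfolding cmul_def prod.case by (rule sum.cong) (auto simp: blk_def)
      then show ?thesis using assms(2) by (simp add: sum.delta)
    qed
    have "cmul m (cmul m (blk m p p (\<lambda>_. 1)) f) (blk m q q (\<lambda>_. 1)) (j, k, p', q') =
      (\<Sum>r\<le>2*m+1. if r = q then blk m p q (\<lambda>(j, k). f (j, k, p, q)) (j, k, p', q') else 0)"
      unfolding cmul_def[of m "cmul m _ f"] prod.case 1 by (rule sum.cong) (auto simp: blk_def)
    then show "cmul m (cmul m (blk m p p (\<lambda>_. 1)) f) (blk m q q (\<lambda>_. 1)) (j, k, p', q') =
       blk m p q (\<lambda>(j, k). f (j, k, p, q)) (j, k, p', q')"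
      using assms(3) by (simp add: sum.delta)
  qed
  then show ?thesis using coefs_cmul[OF coefs_cmul[OF blk_1_mem[OF assms(2)] assms(1)] blk_1_mem[OF assms(3)]]
    by simp
qed

lemma blk_hop_mem:
  assumes "p \<le> 2*m+1" "q \<le> 2*m+1"
  shows "blk m p q (\<lambda>(j, k). hop m j k p q) \<in> coefs m"
proof -
  have "coef m (A1 m) \<in> coefs m" using Terwilliger.gen_A by (auto simp: coefs_def)
  from blk_of_mem[OF this assms]
  have "blk m p q (\<lambda>(j, k). coef m (A1 m) (j, k, p, q)) \<in> coefs m" .
  also have "blk m p q (\<lambda>(j, k). coef m (A1 m) (j, k, p, q)) = blk m p q (\<lambda>(j, k). hop m j k p q)"
    using coef_eq[OF acts_A1] feasible_bounds by (intro blk_cong) auto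
  finally show ?thesis .
qed

text \<open>When the next sphere drops out, one of the upper bounds in \<open>feasible\<close> is
  attained with equality, and this is exactly where the linear factor vanishes. The tridiagonal
  formula thus stops by itself at the boundary of the module.\<close>

lemma hop_up_zero:
  assumes "feasible m j k p" "\<not> feasible m j k (Suc p)"
  shows "hop m j k p (Suc p) = 0"
proof (cases "even p")
  case True
  then have "m + 1 = (p + 1) div 2 + k" using assms by (auto simp: feasible_def)
  then have "of_nat (m + 1) = (of_nat ((p + 1) div 2 + k) :: complex)" by (rule arg_cong)
  then show ?thesis using True by (simp add: hop_def)
next
  case False
  then have "m = p div 2 + j" using assms by (auto simp: feasible_def elim!: oddE)
  then have "of_nat m = (of_nat (p div 2 + j) :: complex)" by (rule arg_cong)
  then show ?thesis using False by (simp add: hop_def)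
qed

lemma hop_down_zero:
  assumes "feasible m j k (Suc p)" "\<not> feasible m j k p"
  shows "hop m j k (Suc p) p = 0"
proof (cases "even p")
  case True
  then have "(Suc p + 1) div 2 = k" using assms by (auto simp: feasible_def elim!: evenE)
  then show ?thesis using True by (simp add: hop_def)
next
  case False
  then have "Suc p div 2 = j" using assms by (auto simp: feasible_def elim!: oddE)
  then show ?thesis using False by (simp add: hop_def)
qed

lemma hop_nonzero:
  assumes "feasible m j k p" "feasible m j k (Suc p)"
  shows "hop m j k p (Suc p) \<noteq> 0" "hop m j k (Suc p) p \<noteq> 0"
proof -
  have "m + 1 \<noteq> (p + 1) div 2 + k" "k \<noteq> (Suc p + 1) div 2" if "even p"
    using assms that by (auto simp: feasible_def elim!: evenE)
  moreover have "m \<noteq> p div 2 + j" "j \<noteq> Suc p div 2" if "odd p"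
    using assms that by (auto simp: feasible_def elim!: oddE)
  ultimately show "hop m j k p (Suc p) \<noteq> 0" "hop m j k (Suc p) p \<noteq> 0"
    unfolding hop_def by (auto simp flip: of_nat_add of_nat_diff of_nat_Suc simp: algebra_simps)
qed

text \<open>The quadratic is symmetric about \<open>(A + B) / 2\<close>, so two distinct arguments
  with equal values must sum to \<open>A + B\<close>.\<close>

lemma quad_inj:
  fixes A B x y n :: nat
  assumes "(of_nat A - of_nat x) * (of_nat B - of_nat x) = (of_nat A - of_nat y) * (of_nat B - of_nat y :: complex)"
    "x + y < A + B"
  shows "x = y"
proof -
  have "(of_nat x - of_nat y) * (of_nat x + of_nat y - of_nat A - of_nat B :: complex) = 0"
    using assms(1) by (simp add: algebra_simps)
  then consider "of_nat x = (of_nat y :: complex)" | "of_nat x + of_nat y = (of_nat A + of_nat B :: complex)"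
    unfolding mult_eq_0_iff by (auto simp: diff_diff_eq)
  then show ?thesis
  proof cases
    case 2
    then have "x + y = A + B" by (metis of_nat_add of_nat_eq_iff)
    then show ?thesis using assms(2) by simp
  qed simp
qed

text \<open>The scalar of the walk \<open>p\<close>, \<open>q\<close>, \<open>p\<close>. Unlike a
  single off-diagonal entry it belongs to a diagonal slice, where products are pointwise and
  polynomials can be formed.\<close>

definition loop :: "nat \<Rightarrow> nat \<Rightarrow> nat \<Rightarrow> nat \<times> nat \<Rightarrow> complex" where
  "loop m p q = (\<lambda>(j, k). hop m j k p q * hop m j k q p)"

text \<open>The product of the two slices carries the condition that \<open>q\<close> be feasible;
  it may be dropped because the hop towards an infeasible sphere is 0 already.\<close>

lemma blk_loop_mem:
  assumes "p \<le> 2*m+1" "q \<le> 2*m+1"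
  shows "blk m p p (loop m p q) \<in> coefs m"
proof -
  have "loop m p q (j, k) = 0" if "feasible m j k p" "\<not> feasible m j k q" for j k
  proof -
    consider "q = Suc p" | "p = Suc q" | "q \<noteq> Suc p" "p \<noteq> Suc q" by blast
    then show ?thesis
      by cases (use that hop_up_zero hop_down_zero in \<open>auto simp: loop_def hop_def\<close>)
  qed
  then have "blk m p p (loop m p q) = blk m p p (\<lambda>(j, k). if feasible m j k q then
      (\<lambda>(j, k). hop m j k p q) (j, k) * (\<lambda>(j, k). hop m j k q p) (j, k) else 0)"
    by (intro blk_cong) (auto simp: loop_def)
  then show ?thesis
    using blk_mult_mem[OF blk_hop_mem[OF assms] blk_hop_mem[OF assms(2,1)] assms(2)] by simp
qed

text \<open>Of the two neighbouring spheres, one gives a quadratic in \<open>j\<close> with sum of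
  roots \<open>m + 1\<close>, the other a quadratic in \<open>k\<close> with sum of roots
  \<open>m + 2\<close>. Since \<open>j + j' \<le> m\<close> and \<open>k + k' \<le> m + 1\<close>,
  both are injective on the weights concerned.\<close>

lemma loops_separate:
  assumes "feasible m j k p" "feasible m j' k' p" "(j, k) \<noteq> (j', k')"
  obtains q where "q \<le> 2*m+1" "loop m p q (j, k) \<noteq> loop m p q (j', k')"
proof -
  note b = feasible_bounds[OF assms(1)] feasible_bounds[OF assms(2)]
  \<comment> \<open>On the first and the last sphere only the weights \<open>(0, 0)\<close> are
    feasible, so two distinct pairs force \<open>p\<close> to have both neighbours.\<close>
  have "p \<noteq> 0" "p \<noteq> 2*m+1"
    using assms by (auto simp: feasible_def)
  then obtain r where r: "p = Suc r" "Suc p \<le> 2*m+1" using b(3) by (cases p) auto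
  show thesis
  proof (cases "even p")
    case True
    then obtain i where i: "p = 2 * i" by (auto elim: evenE)
    have up: "loop m p (Suc p) (x, y) = (of_nat (m + 1 - i) - of_nat y) * (of_nat (i + 1) - of_nat y)" for x y
      using i r by (simp add: loop_def hop_def of_nat_diff)
    have down: "loop m p r (x, y) = (of_nat i - of_nat x) * (of_nat (m + 1 - i) - of_nat x)" for x y
    proof -
      have "i = Suc (r div 2)" "odd r" using i r by (auto elim!: oddE) presburger+
      then show ?thesis using i r by (simp add: loop_def hop_def of_nat_diff)
    qed
    have "i \<le> m" using i r by simp
    then have "j + j' < i + (m + 1 - i)" "k + k' < (m + 1 - i) + (i + 1)" using b by linarith+
    then show thesis using that[of "Suc p"] that[of r] quad_inj up down r assms(3) by (metis Suc_leD)
  next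
    case False
    then obtain i where i: "p = 2 * i + 1" by (auto elim: oddE)
    have up: "loop m p (Suc p) (x, y) = (of_nat (m - i) - of_nat x) * (of_nat (i + 1) - of_nat x)" for x y
      using i r by (simp add: loop_def hop_def of_nat_diff)
    have down: "loop m p r (x, y) = (of_nat (i + 1) - of_nat y) * (of_nat (m + 1 - i) - of_nat y)" for x y
      using i r by (simp add: loop_def hop_def of_nat_diff)
    have "i \<le> m" using i r by simp
    then have "j + j' < (m - i) + (i + 1)" "k + k' < (i + 1) + (m + 1 - i)" using b by linarith+
    then show thesis using that[of "Suc p"] that[of r] quad_inj up down r assms(3) by (metis Suc_leD)
  qed
qed

lemma finite_feasible: "finite {(j, k). feasible m j k p}"
  by (rule finite_subset[of _ "{..m} \<times> {..m+1}"]) (auto simp: feasible_def)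

text \<open>Lagrange interpolation with one factor for each pair to be excluded. The neighbour used
  to separate may change from factor to factor.\<close>

lemma separating_polynomial:
  assumes "finite B" "B \<subseteq> {(j, k). feasible m j k p}" "b0 \<notin> B" "b0 \<in> {(j, k). feasible m j k p}"
  shows "\<exists>f. blk m p p f \<in> coefs m \<and> f b0 = 1 \<and> (\<forall>b\<in>B. f b = 0)"
  using assms
proof (induction B)
  case empty
  then have "p \<le> 2*m+1" using feasible_bounds by auto
  then show ?case using blk_1_mem by (intro exI[of _ "\<lambda>_. 1"]) auto
next
  case (insert b B)
  then obtain f where f: "blk m p p f \<in> coefs m" "f b0 = 1" "\<forall>b\<in>B. f b = 0" by auto
  obtain j k where b: "b = (j, k)" by fastforce
  obtain j0 k0 where b0: "b0 = (j0, k0)" by fastforce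
  have fe: "feasible m j0 k0 p" "feasible m j k p" "(j0, k0) \<noteq> (j, k)" using insert.prems b b0 by auto
  then have p: "p \<le> 2*m+1" using feasible_bounds by blast
  obtain q where q: "q \<le> 2*m+1" "loop m p q b0 \<noteq> loop m p q b"
    using loops_separate[OF fe] b b0 by metis
  \<comment> \<open>The normalised linear factor, 1 at \<open>b0\<close> and 0 at \<open>b\<close>.
    The factor \<open>* 1\<close> exhibits the constant term as a multiple of the image of
    \<open>Estar m p\<close>.\<close>
  define g where "g x = (1 / (loop m p q b0 - loop m p q b)) * (loop m p q x + (- loop m p q b) * 1)" for x
  have g: "g b0 = 1" "g b = 0" using q(2) by (auto simp: g_def)
  have "blk m p p g \<in> coefs m"
    unfolding g_def by (intro blk_smult_mem blk_add_mem blk_loop_mem blk_1_mem p q(1))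
  from blk_mult_mem[OF f(1) this p]
  have "blk m p p (\<lambda>(j, k). if feasible m j k p then f (j, k) * g (j, k) else 0) \<in> coefs m" .
  also have "blk m p p (\<lambda>(j, k). if feasible m j k p then f (j, k) * g (j, k) else 0) = blk m p p (\<lambda>b. f b * g b)"
    by (rule blk_cong) simp
  finally show ?case using f g by (intro exI[of _ "\<lambda>b. f b * g b"]) auto
qed

lemma unit_diag_mem:
  assumes "feasible m j k p"
  shows "blk m p p (\<lambda>b. if b = (j, k) then 1 else 0) \<in> coefs m"
proof -
  let ?B = "{(j, k). feasible m j k p} - {(j, k)}"
  obtain f where f: "blk m p p f \<in> coefs m" "f (j, k) = 1" "\<forall>b\<in>?B. f b = 0"
    using separating_polynomial[of ?B m p "(j, k)"] finite_feasible assms by auto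
  have "blk m p p f = blk m p p (\<lambda>b. if b = (j, k) then 1 else 0)"
    by (rule blk_cong) (use f in auto)
  then show ?thesis using f(1) by simp
qed

lemma unit_trans:
  assumes "blk m p r (\<lambda>b. if b = (j, k) then 1 else 0) \<in> coefs m"
    "blk m r q (\<lambda>b. if b = (j, k) then 1 else 0) \<in> coefs m" "feasible m j k r"
  shows "blk m p q (\<lambda>b. if b = (j, k) then 1 else 0) \<in> coefs m"
proof -
  have "r \<le> 2*m+1" using assms(3) feasible_bounds by blast
  note blk_mult_mem[OF assms(1,2) this]
  also have "blk m p q (\<lambda>(j', k'). if feasible m j' k' r then
      (\<lambda>b. if b = (j, k) then 1 else 0) (j', k') * (\<lambda>b. if b = (j, k) then 1 else 0) (j', k') else 0)
    = blk m p q (\<lambda>b. if b = (j, k) then 1 else 0)"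
    by (rule blk_cong) (use assms(3) in auto)
  finally show ?thesis .
qed

lemma unit_hop_mem:
  assumes "feasible m j k p" "feasible m j k q" "hop m j k p q \<noteq> 0"
  shows "blk m p q (\<lambda>b. if b = (j, k) then 1 else 0) \<in> coefs m"
proof -
  have p: "p \<le> 2*m+1" "q \<le> 2*m+1" using assms feasible_bounds by blast+
  note blk_smult_mem[OF blk_mult_mem[OF unit_diag_mem[OF assms(1)] blk_hop_mem[OF p] p(1)], of "1 / hop m j k p q"]
  also have "blk m p q (\<lambda>b. 1 / hop m j k p q * (case b of (j', k') \<Rightarrow> if feasible m j' k' p then
      (if (j', k') = (j, k) then 1 else 0) * (case (j', k') of (j, k) \<Rightarrow> hop m j k p q) else 0))
    = blk m p q (\<lambda>b. if b = (j, k) then 1 else 0)"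
    by (rule blk_cong) (use assms in auto)
  finally show ?thesis .
qed

lemma feasible_between:
  assumes "feasible m j k p" "feasible m j k q" "p \<le> r" "r \<le> q"
  shows "feasible m j k r"
proof -
  have "p div 2 \<le> r div 2" "r div 2 \<le> q div 2" "(p + 1) div 2 \<le> (r + 1) div 2" "(r + 1) div 2 \<le> (q + 1) div 2"
    using assms(3,4) by (simp_all add: div_le_mono)
  then show ?thesis using assms(1,2) unfolding feasible_def by linarith
qed

text \<open>The feasible spheres form an interval inside which no hop vanishes in either direction.
  Rescaled hops are therefore units between neighbours, and composing them reaches every pair of
  spheres.\<close>

lemma unit_mem:
  assumes "feasible m j k p" "feasible m j k q"
  shows "blk m p q (\<lambda>b. if b = (j, k) then 1 else 0) \<in> coefs m"
proof -
  have le: "blk m p q (\<lambda>b. if b = (j, k) then 1 else 0) \<in> coefs m \<and>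
        blk m q p (\<lambda>b. if b = (j, k) then 1 else 0) \<in> coefs m"
    if "p \<le> q" "feasible m j k p" "feasible m j k q" for p q
    using that
  proof (induction rule: dec_induct)
    case base
    then show ?case using unit_diag_mem by blast
  next
    case (step n)
    have n: "feasible m j k n" using feasible_between[OF step.prems] step.hyps by simp
    note h = hop_nonzero[OF n step.prems(2)]
    show ?case
      using unit_trans[OF _ unit_hop_mem[OF n step.prems(2) h(1)] n]
        unit_trans[OF unit_hop_mem[OF step.prems(2) n h(2)] _ n] step.IH step.prems(1) n by blast
  qed
  show ?thesis using le[of p q] le[of q p] assms by (cases "p \<le> q") auto
qed

definition idx :: "nat \<Rightarrow> (nat \<times> nat \<times> nat \<times> nat) set" where
  "idx m = {(j, k, p, q). feasible m j k p \<and> feasible m j k q}"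

lemma finite_idx: "finite (idx m)"
  by (rule finite_subset[of _ "{..m} \<times> {..m+1} \<times> {..2*m+1} \<times> {..2*m+1}"])
    (auto simp: idx_def dest: feasible_bounds(3), auto simp: feasible_def)

lemma coefs_eq: "coefs m = {f. \<forall>x. x \<notin> idx m \<longrightarrow> f x = 0}"
proof
  show "coefs m \<subseteq> {f. \<forall>x. x \<notin> idx m \<longrightarrow> f x = 0}"
    using coef_eq_0 by (fastforce simp: coefs_def idx_def)
next
  show "{f. \<forall>x. x \<notin> idx m \<longrightarrow> f x = 0} \<subseteq> coefs m"
  proof
    fix f :: "nat \<times> nat \<times> nat \<times> nat \<Rightarrow> complex"
    assume f: "f \<in> {f. \<forall>x. x \<notin> idx m \<longrightarrow> f x = 0}"
    have "(\<lambda>x. if x \<in> I then f x else 0) \<in> coefs m" if "finite I" "I \<subseteq> idx m" for I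
      using that
    proof (induction I)
      case empty
      \<comment> \<open>Any matrix unit scaled by 0 gives the zero function; weights
        \<open>(0, 0)\<close> on sphere 0 are always available.\<close>
      have "feasible m 0 0 0" by (simp add: feasible_def)
      from coefs_smult[OF unit_mem[OF this this], of 0] show ?case by simp
    next
      case (insert i I)
      obtain j k p q where i: "i = (j, k, p, q)" by (metis surj_pair)
      then have "feasible m j k p" "feasible m j k q" using insert.prems by (auto simp: idx_def)
      note u = unit_mem[OF this]
      have "(\<lambda>x. if x \<in> insert i I then f x else 0) =
         (\<lambda>x. f i * blk m p q (\<lambda>b. if b = (j, k) then 1 else 0) x + (if x \<in> I then f x else 0))"
        using \<open>feasible m j k p\<close> \<open>feasible m j k q\<close> insert.hyps i by (auto simp: fun_eq_iff blk_def)
      then show ?case using coefs_add[OF coefs_smult[OF u, of "f i"] insert.IH] insert.prems by auto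
    qed
    from this[OF finite_idx] have "(\<lambda>x. if x \<in> idx m then f x else 0) \<in> coefs m" by blast
    also have "(\<lambda>x. if x \<in> idx m then f x else 0) = f" using f by auto
    finally show "f \<in> coefs m" .
  qed
qed

section \<open>Invariance and the dimension bound\<close>

text \<open>A nonzero kernel vector together with preimages of the unit vectors would be
  \<open>card I + 1\<close> independent vectors in a span of at most \<open>card I\<close> vectors.
  Linearity is required on \<open>W\<close> only, because \<open>coef\<close> is controlled only on
  the algebra.\<close>

lemma (in vector_space) surjective_imp_injective:
  fixes \<phi> :: "'b \<Rightarrow> 'i \<Rightarrow> 'a"
  assumes fin: "finite I" and W: "subspace W" "W \<subseteq> span (G ` I)"
    and add: "\<And>x y i. x \<in> W \<Longrightarrow> y \<in> W \<Longrightarrow> \<phi> (x + y) i = \<phi> x i + \<phi> y i"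
    and scale: "\<And>c x i. x \<in> W \<Longrightarrow> \<phi> (scale c x) i = c * \<phi> x i"
    and surj: "\<And>l. l \<in> I \<Longrightarrow> \<exists>x\<in>W. \<forall>i\<in>I. \<phi> x i = (if i = l then 1 else 0)"
    and x: "x \<in> W" "\<And>i. i \<in> I \<Longrightarrow> \<phi> x i = 0"
  shows "x = 0"
proof (rule ccontr)
  assume "x \<noteq> 0"
  obtain N where N: "\<And>l. l \<in> I \<Longrightarrow> N l \<in> W" "\<And>l i. l \<in> I \<Longrightarrow> i \<in> I \<Longrightarrow> \<phi> (N l) i = (if i = l then 1 else 0)"
    using surj by metis
  have "finite (insert x (N ` J)) \<and> independent (insert x (N ` J)) \<and> card (insert x (N ` J)) = Suc (card J)"
    if "finite J" "J \<subseteq> I" for J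
    using that
  proof (induction J)
    case empty
    then show ?case using \<open>x \<noteq> 0\<close> by simp
  next
    case (insert l J)
    then have l: "l \<in> I" by simp
    \<comment> \<open>Coordinate \<open>l\<close> vanishes on \<open>x\<close> and on all preimages
      collected so far, hence on their span, whereas it is 1 at \<open>N l\<close>.\<close>
    have sub: "subspace {v \<in> W. \<phi> v l = 0}"
    proof (rule subspaceI)
      have "\<phi> 0 l = 0" using scale[of 0 0 l] subspace_0[OF W(1)] by simp
      then show "0 \<in> {v \<in> W. \<phi> v l = 0}" using subspace_0[OF W(1)] by simp
    qed (use subspace_add[OF W(1)] subspace_scale[OF W(1)] add scale in auto)
    have "insert x (N ` J) \<subseteq> {v \<in> W. \<phi> v l = 0}"
      using x N l insert.hyps insert.prems by auto
    then have "span (insert x (N ` J)) \<subseteq> {v \<in> W. \<phi> v l = 0}" using span_minimal sub by blast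
    moreover have "\<phi> (N l) l = 1" using N l by simp
    ultimately have n: "N l \<notin> span (insert x (N ` J))" by auto
    then have "N l \<notin> insert x (N ` J)" using span_superset by (rule contra_subsetD[rotated])
    moreover have eq: "insert x (N ` insert l J) = insert (N l) (insert x (N ` J))" by blast
    moreover have "J \<subseteq> I" using insert.prems by simp
    ultimately show ?case
      using insert.IH insert.hyps independent_insertI[OF n] unfolding eq by (simp del: insert_iff)
  qed
  from this[OF fin] have *: "finite (insert x (N ` I))" "independent (insert x (N ` I))"
    "card (insert x (N ` I)) = Suc (card I)" by auto
  have "insert x (N ` I) \<subseteq> span (G ` I)" using x(1) N(1) W(2) by auto
  then have "card (insert x (N ` I)) \<le> card (G ` I)"
    using independent_span_bound[OF _ *(2)] fin by blast
  then show False using *(3) card_image_le[OF fin, of G] by simp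
qed

lemma bij_betw_same_fibres:
  assumes "finite Z" "\<And>l. card {x \<in> Z. c x = l} = card {x \<in> Z. c' x = l}"
  obtains \<pi> where "bij_betw \<pi> Z Z" "\<And>x. x \<in> Z \<Longrightarrow> c' (\<pi> x) = c x"
proof -
  have "\<exists>f. bij_betw f {x \<in> Z. c x = l} {x \<in> Z. c' x = l}" for l
    using assms by (intro finite_same_card_bij) auto
  then obtain f where f: "\<And>l. bij_betw (f l) {x \<in> Z. c x = l} {x \<in> Z. c' x = l}" by metis
  have im: "f (c x) x \<in> Z \<and> c' (f (c x) x) = c x" if "x \<in> Z" for x
    using bij_betw_apply[OF f[of "c x"], of x] that by simp
  have inj: "inj_on (\<lambda>x. f (c x) x) Z"
  proof (rule inj_onI)
    fix x y assume xy: "x \<in> Z" "y \<in> Z" "f (c x) x = f (c y) y"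
    then have "c x = c y" using im by metis
    then show "x = y" using xy inj_onD[OF bij_betw_imp_inj_on[OF f[of "c x"]], of x y] by simp
  qed
  moreover have "(\<lambda>x. f (c x) x) ` Z = Z"
    by (rule endo_inj_surj[OF assms(1) _ inj]) (use im in auto)
  ultimately show thesis using that[of "\<lambda>x. f (c x) x"] im unfolding bij_betw_def by blast
qed

text \<open>Two subsets cut \<open>Z\<close> into four regions whose sizes follow by
  inclusion-exclusion from three cardinalities. These three therefore classify pairs of subsets up
  to permutations of \<open>Z\<close>.\<close>

lemma card_region:
  assumes "finite Z"
  shows "card {x \<in> Z. (x \<in> y, x \<in> z) = l} =
    (case l of (True, True) \<Rightarrow> card (y \<inter> z \<inter> Z)
     | (True, False) \<Rightarrow> card (y \<inter> Z) - card (y \<inter> z \<inter> Z)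
     | (False, True) \<Rightarrow> card (z \<inter> Z) - card (y \<inter> z \<inter> Z)
     | (False, False) \<Rightarrow> card Z - (card (y \<inter> Z) + card (z \<inter> Z) - card (y \<inter> z \<inter> Z)))"
proof -
  have "{x \<in> Z. (x \<in> y, x \<in> z) = (True, True)} = y \<inter> z \<inter> Z" by auto
  moreover have "{x \<in> Z. (x \<in> y, x \<in> z) = (True, False)} = y \<inter> Z - y \<inter> z \<inter> Z" by auto
  moreover have "{x \<in> Z. (x \<in> y, x \<in> z) = (False, True)} = z \<inter> Z - y \<inter> z \<inter> Z" by auto
  moreover have "{x \<in> Z. (x \<in> y, x \<in> z) = (False, False)} = Z - (y \<inter> Z \<union> z \<inter> Z)" by auto
  moreover have "card (y \<inter> Z \<union> z \<inter> Z) = card (y \<inter> Z) + card (z \<inter> Z) - card (y \<inter> z \<inter> Z)"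
  proof -
    have "(y \<inter> Z) \<inter> (z \<inter> Z) = y \<inter> z \<inter> Z" by auto
    then show ?thesis using card_Un_Int[of "y \<inter> Z" "z \<inter> Z"] assms by simp
  qed
  moreover have "card (y \<inter> Z - y \<inter> z \<inter> Z) = card (y \<inter> Z) - card (y \<inter> z \<inter> Z)"
    "card (z \<inter> Z - y \<inter> z \<inter> Z) = card (z \<inter> Z) - card (y \<inter> z \<inter> Z)"
    "card (Z - (y \<inter> Z \<union> z \<inter> Z)) = card Z - card (y \<inter> Z \<union> z \<inter> Z)"
    using assms by (intro card_Diff_subset; auto)+
  ultimately show ?thesis by (cases l; cases "fst l"; cases "snd l") simp_all
qed

lemma pair_transport:
  assumes "finite Z" "card (y \<inter> Z) = card (y' \<inter> Z)" "card (z \<inter> Z) = card (z' \<inter> Z)"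
    "card (y \<inter> z \<inter> Z) = card (y' \<inter> z' \<inter> Z)"
  obtains \<pi> where "bij_betw \<pi> Z Z" "\<And>x. x \<in> Z \<Longrightarrow> (\<pi> x \<in> y' \<longleftrightarrow> x \<in> y) \<and> (\<pi> x \<in> z' \<longleftrightarrow> x \<in> z)"
proof -
  have "card {x \<in> Z. (x \<in> y, x \<in> z) = l} = card {x \<in> Z. (x \<in> y', x \<in> z') = l}" for l
    unfolding card_region[OF assms(1)] assms(2-4) ..
  from bij_betw_same_fibres[OF assms(1) this] obtain \<pi> where
    "bij_betw \<pi> Z Z" "\<And>x. x \<in> Z \<Longrightarrow> (\<pi> x \<in> y', \<pi> x \<in> z') = (x \<in> y, x \<in> z)" by metis
  then show thesis using that[of \<pi>] by blast
qed

section \<open>The stabiliser of the base vertex and its orbits on pairs of vertices\<close>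

definition stab_perm :: "nat \<Rightarrow> (nat \<Rightarrow> nat) \<Rightarrow> bool" where
  "stab_perm m \<pi> \<longleftrightarrow> bij_betw \<pi> (x0 m) (x0 m) \<and> bij_betw \<pi> (C_set m) (C_set m)"

lemma stab_perm_S:
  assumes "stab_perm m \<pi>"
  shows "bij_betw \<pi> (S_set m) (S_set m)"
  using assms bij_betw_combine[of \<pi> "x0 m" "x0 m" "C_set m" "C_set m"] x0_C_disj S_eq
  unfolding stab_perm_def by metis

lemma stab_perm_level:
  assumes "stab_perm m \<pi>" "y \<in> level m p"
  shows "\<pi> ` y \<in> level m p"
proof -
  note S = stab_perm_S[OF assms(1)] and c = level_cards[OF assms(2)]
  have inj: "inj_on \<pi> (S_set m)" and im: "\<pi> ` S_set m = S_set m"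
    using S by (auto simp: bij_betw_def)
  have "card (\<pi> ` y \<inter> Z) = card (y \<inter> Z)" if "bij_betw \<pi> Z Z" "Z \<subseteq> S_set m" for Z
  proof -
    have "\<pi> ` y \<inter> Z = \<pi> ` (y \<inter> Z)"
      using inj_on_image_Int[OF inj c(1) that(2)] that(1) by (simp add: bij_betw_def)
    then show ?thesis using card_image[of \<pi> "y \<inter> Z"] inj_on_subset[OF inj, of "y \<inter> Z"] c(1) by auto
  qed
  then show ?thesis
    using assms(1) c im S_eq unfolding level_def stab_perm_def by auto
qed

lemma stab_perm_X:
  assumes "stab_perm m \<pi>" "y \<in> X_set m"
  shows "\<pi> ` y \<in> X_set m"
  using assms stab_perm_level level_subset_X by (metis X_level subsetD)

lemma stab_perm_bij_X:
  assumes "stab_perm m \<pi>"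
  shows "bij_betw ((`) \<pi>) (X_set m) (X_set m)"
proof -
  have "inj_on ((`) \<pi>) (Pow (S_set m))"
    using inj_on_image_Pow stab_perm_S[OF assms] by (auto simp: bij_betw_def)
  then have inj: "inj_on ((`) \<pi>) (X_set m)" by (rule inj_on_subset) (auto simp: X_set_def)
  then have "(`) \<pi> ` X_set m = X_set m"
    using stab_perm_X[OF assms] by (intro endo_inj_surj) auto
  with inj show ?thesis by (simp add: bij_betw_def)
qed

text \<open>The generators are defined by inclusion and by distance from the base vertex, both
  respected by the stabiliser. For products, the group action reindexes the sum over the
  intermediate vertex.\<close>

lemma Terwilliger_invariant:
  assumes "M \<in> Terwilliger m" "stab_perm m \<pi>" "y \<in> X_set m" "z \<in> X_set m"
  shows "M (\<pi> ` y) (\<pi> ` z) = M y z"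
  using assms(1,3,4)
proof (induction arbitrary: y z)
  case gen_A
  have inj: "inj_on \<pi> (S_set m)" using stab_perm_S[OF assms(2)] by (simp add: bij_betw_def)
  have yz: "y \<subseteq> S_set m" "z \<subseteq> S_set m" using gen_A by (auto simp: X_set_def)
  have "\<pi> ` u \<subseteq> \<pi> ` v \<longleftrightarrow> u \<subseteq> v" if "u \<subseteq> S_set m" "v \<subseteq> S_set m" for u v
    unfolding image_subset_iff using inj_on_image_mem_iff[OF inj _ that(2)] that(1) by blast
  then have "\<pi> ` y \<subseteq> \<pi> ` z \<longleftrightarrow> y \<subseteq> z" "\<pi> ` z \<subseteq> \<pi> ` y \<longleftrightarrow> z \<subseteq> y"
    using yz by blast+
  then have "\<pi> ` y \<subset> \<pi> ` z \<longleftrightarrow> y \<subset> z" "\<pi> ` z \<subset> \<pi> ` y \<longleftrightarrow> z \<subset> y"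
    by (simp_all add: less_le_not_le)
  then show ?case using gen_A stab_perm_X[OF assms(2)] by (simp add: A1_def adj_def)
next
  case (gen_E i)
  have "\<pi> ` y = \<pi> ` z \<longleftrightarrow> y = z"
    using stab_perm_bij_X[OF assms(2)] gen_E by (meson bij_betw_def inj_on_eq_iff)
  moreover have "\<pi> ` y \<in> level m i \<longleftrightarrow> y \<in> level m i"
  proof -
    obtain p where p: "p \<le> 2*m+1" "y \<in> level m p" using X_level gen_E by blast
    show ?thesis using level_unique[OF p(2) _ p(1) gen_E(1)] p(2)
        level_unique[OF stab_perm_level[OF assms(2) p(2)] _ p(1) gen_E(1)] stab_perm_level[OF assms(2)] by metis
  qed
  ultimately show ?case unfolding Estar_eq[OF gen_E(1)] by simp
next
  case (mult M N)
  have "xmult m M N (\<pi> ` y) (\<pi> ` z) = (\<Sum>w\<in>X_set m. M (\<pi> ` y) (\<pi> ` w) * N (\<pi> ` w) (\<pi> ` z))"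
    unfolding xmult_def
    by (rule sum.reindex_bij_betw[OF stab_perm_bij_X[OF assms(2)], symmetric])
  then show ?case unfolding xmult_def using mult by simp
qed (simp_all add: xadd_def xsmult_def)

lemma Terwilliger_outside:
  assumes "M \<in> Terwilliger m" "y \<notin> X_set m \<or> z \<notin> X_set m"
  shows "M y z = 0"
  using assms by (induction arbitrary: y z) (auto simp: A1_def adj_def Estar_def xadd_def xsmult_def xmult_def)

lemma image_eq_of_iff:
  assumes "bij_betw \<pi> S S" "y \<subseteq> S" "y' \<subseteq> S" "\<And>x. x \<in> S \<Longrightarrow> \<pi> x \<in> y' \<longleftrightarrow> x \<in> y"
  shows "\<pi> ` y = y'"
proof
  show "\<pi> ` y \<subseteq> y'" using assms(2,4) by blast
  show "y' \<subseteq> \<pi> ` y"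
  proof
    fix v assume "v \<in> y'"
    moreover then obtain x where "x \<in> S" "v = \<pi> x" using assms(1,3) unfolding bij_betw_def by blast
    ultimately show "v \<in> \<pi> ` y" using assms(4) by blast
  qed
qed

lemma Terwilliger_orbit:
  assumes "M \<in> Terwilliger m" "p \<le> 2*m+1" "q \<le> 2*m+1"
    and y: "y \<in> level m p" "y' \<in> level m p" and z: "z \<in> level m q" "z' \<in> level m q"
    and x0: "card (y \<inter> z \<inter> x0 m) = card (y' \<inter> z' \<inter> x0 m)"
    and C: "card (y \<inter> z \<inter> C_set m) = card (y' \<inter> z' \<inter> C_set m)"
  shows "M y z = M y' z'"
proof -
  note cy = level_cards[OF y(1)] level_cards[OF y(2)] and cz = level_cards[OF z(1)] level_cards[OF z(2)]
  obtain f where f: "bij_betw f (x0 m) (x0 m)"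
    "\<And>x. x \<in> x0 m \<Longrightarrow> (f x \<in> y' \<longleftrightarrow> x \<in> y) \<and> (f x \<in> z' \<longleftrightarrow> x \<in> z)"
    using pair_transport[of "x0 m" y y' z z'] cy(3,7) cz(3,7) x0 by auto
  obtain g where g: "bij_betw g (C_set m) (C_set m)"
    "\<And>x. x \<in> C_set m \<Longrightarrow> (g x \<in> y' \<longleftrightarrow> x \<in> y) \<and> (g x \<in> z' \<longleftrightarrow> x \<in> z)"
    using pair_transport[of "C_set m" y y' z z'] cy(4,8) cz(4,8) C by auto
  define \<pi> where "\<pi> x = (if x \<in> x0 m then f x else g x)" for x
  have "bij_betw \<pi> (x0 m) (x0 m)" using f(1) by (subst bij_betw_cong[of _ _ f]) (auto simp: \<pi>_def)
  moreover have "bij_betw \<pi> (C_set m) (C_set m)" using g(1) x0_C_disj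
    by (subst bij_betw_cong[of _ _ g]) (auto simp: \<pi>_def)
  ultimately have s: "stab_perm m \<pi>" by (simp add: stab_perm_def)
  have iff: "(\<pi> x \<in> y' \<longleftrightarrow> x \<in> y) \<and> (\<pi> x \<in> z' \<longleftrightarrow> x \<in> z)" if "x \<in> S_set m" for x
    using that f(2) g(2) x0_C_disj S_eq by (auto simp: \<pi>_def)
  have "\<pi> ` y = y'" "\<pi> ` z = z'"
    using image_eq_of_iff[OF stab_perm_S[OF s]] iff cy cz by blast+
  moreover have "y \<in> X_set m" "z \<in> X_set m" using level_subset_X assms(2,3) y z by blast+
  ultimately show ?thesis using Terwilliger_invariant[OF assms(1) s] by metis
qed

text \<open>The shifts are the least possible sizes of the two intersections, which are 0 through truncated
  subtraction when the sets are small; they make \<open>j\<close> and \<open>k\<close> range over exactly the weights feasible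
  for both spheres.\<close>

definition orb :: "nat \<Rightarrow> nat \<times> nat \<times> nat \<times> nat \<Rightarrow> xmat" where
  "orb m = (\<lambda>(j, k, p, q) y z. if y \<in> level m p \<and> z \<in> level m q
     \<and> card (y \<inter> z \<inter> x0 m) - ((m - p div 2) + (m - q div 2) - m) = j
     \<and> card (y \<inter> z \<inter> C_set m) - ((p + 1) div 2 + (q + 1) div 2 - (m + 1)) = k then 1 else 0)"

lemma orb_nonzeroD:
  assumes "orb m (j, k, p, q) y z \<noteq> 0"
  shows "y \<in> level m p" "z \<in> level m q"
    "card (y \<inter> z \<inter> x0 m) - ((m - p div 2) + (m - q div 2) - m) = j"
    "card (y \<inter> z \<inter> C_set m) - ((p + 1) div 2 + (q + 1) div 2 - (m + 1)) = k"
proof -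
  have "P" if "(if P then 1 else 0 :: complex) \<noteq> 0" for P using that by (cases P) simp_all
  from this[OF assms[unfolded orb_def prod.case]] show "y \<in> level m p" "z \<in> level m q"
    "card (y \<inter> z \<inter> x0 m) - ((m - p div 2) + (m - q div 2) - m) = j"
    "card (y \<inter> z \<inter> C_set m) - ((p + 1) div 2 + (q + 1) div 2 - (m + 1)) = k" by blast+
qed

lemma card_Int_bounds:
  assumes "finite Z"
  shows "card (y \<inter> Z) + card (z \<inter> Z) - card Z \<le> card (y \<inter> z \<inter> Z)"
    "card (y \<inter> z \<inter> Z) \<le> card (y \<inter> Z)" "card (y \<inter> z \<inter> Z) \<le> card (z \<inter> Z)"
proof -
  have "(y \<inter> Z) \<inter> (z \<inter> Z) = y \<inter> z \<inter> Z" by auto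
  moreover have "card (y \<inter> Z \<union> z \<inter> Z) \<le> card Z" using assms by (intro card_mono) auto
  ultimately show "card (y \<inter> Z) + card (z \<inter> Z) - card Z \<le> card (y \<inter> z \<inter> Z)"
    using card_Un_Int[of "y \<inter> Z" "z \<inter> Z"] assms by simp
qed (use assms in \<open>auto intro!: card_mono\<close>)

text \<open>An intersection size minus its least possible value lies between 0 and
  \<open>min(a, b, n-a, n-b)\<close>. The second form serves the lattice of \<open>x0 m\<close>,
  where \<open>p div 2\<close> counts the missing points, so that the sets have sizes
  \<open>n - a\<close> and \<open>n - b\<close>.\<close>

lemma truncated_diff_bounds:
  fixes a b n s :: nat
  assumes "a \<le> n" "b \<le> n"
  shows "s \<le> a \<Longrightarrow> s \<le> b \<Longrightarrow>
      s - (a + b - n) \<le> a \<and> a + (s - (a + b - n)) \<le> n \<and> s - (a + b - n) \<le> b \<and> b + (s - (a + b - n)) \<le> n"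
    "s \<le> n - a \<Longrightarrow> s \<le> n - b \<Longrightarrow>
      s - ((n - a) + (n - b) - n) \<le> a \<and> a + (s - ((n - a) + (n - b) - n)) \<le> n \<and>
      s - ((n - a) + (n - b) - n) \<le> b \<and> b + (s - ((n - a) + (n - b) - n)) \<le> n"
  using assms by auto

lemma orb_idx:
  assumes "y \<in> level m p" "z \<in> level m q" "p \<le> 2*m+1" "q \<le> 2*m+1"
  shows "\<exists>j k. (j, k, p, q) \<in> idx m \<and> orb m (j, k, p, q) y z = 1"
proof -
  note cy = level_cards[OF assms(1)] and cz = level_cards[OF assms(2)]
  define j where "j = card (y \<inter> z \<inter> x0 m) - ((m - p div 2) + (m - q div 2) - m)"
  define k where "k = card (y \<inter> z \<inter> C_set m) - ((p + 1) div 2 + (q + 1) div 2 - (m + 1))"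
  have le: "p div 2 \<le> m" "q div 2 \<le> m" "(p + 1) div 2 \<le> m + 1" "(q + 1) div 2 \<le> m + 1"
    using assms(3,4) by auto
  have "j \<le> p div 2 \<and> p div 2 + j \<le> m \<and> j \<le> q div 2 \<and> q div 2 + j \<le> m"
    unfolding j_def using truncated_diff_bounds(2)[OF le(1,2)] card_Int_bounds(2,3)[OF finite_x0[of m], where y = y and z = z]
    unfolding cy(3) cz(3) by blast
  moreover have "k \<le> (p + 1) div 2 \<and> (p + 1) div 2 + k \<le> m + 1 \<and> k \<le> (q + 1) div 2 \<and> (q + 1) div 2 + k \<le> m + 1"
    unfolding k_def using truncated_diff_bounds(1)[OF le(3,4)] card_Int_bounds(2,3)[OF finite_C[of m], where y = y and z = z]
    unfolding cy(4) cz(4) by blast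
  ultimately have "(j, k, p, q) \<in> idx m" by (simp add: idx_def feasible_def)
  moreover have "orb m (j, k, p, q) y z = 1" using assms(1,2) by (simp add: orb_def j_def k_def)
  ultimately show ?thesis by blast
qed

lemma Terwilliger_orb:
  assumes "M \<in> Terwilliger m" "i \<in> idx m" "orb m i y z \<noteq> 0" "orb m i y' z' \<noteq> 0"
  shows "M y z = M y' z'"
proof -
  obtain j k p q where i: "i = (j, k, p, q)" by (metis surj_pair)
  then have pq: "p \<le> 2*m+1" "q \<le> 2*m+1" using assms(2) feasible_bounds(3) unfolding idx_def by auto
  note o = orb_nonzeroD[OF assms(3)[unfolded i]] orb_nonzeroD[OF assms(4)[unfolded i]]
  note c = level_cards(3,4)[OF o(1)] level_cards(3,4)[OF o(2)] level_cards(3,4)[OF o(5)] level_cards(3,4)[OF o(6)]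
  \<comment> \<open>Above the least intersection size the subtraction in the label is exact, so
    equal labels give equal intersection sizes.\<close>
  have b: "(m - p div 2) + (m - q div 2) - m \<le> card (y \<inter> z \<inter> x0 m)"
    "(m - p div 2) + (m - q div 2) - m \<le> card (y' \<inter> z' \<inter> x0 m)"
    "(p + 1) div 2 + (q + 1) div 2 - (m + 1) \<le> card (y \<inter> z \<inter> C_set m)"
    "(p + 1) div 2 + (q + 1) div 2 - (m + 1) \<le> card (y' \<inter> z' \<inter> C_set m)"
    using card_Int_bounds(1)[OF finite_x0[of m], where y = y and z = z]
      card_Int_bounds(1)[OF finite_x0[of m], where y = y' and z = z']
      card_Int_bounds(1)[OF finite_C[of m], where y = y and z = z]
      card_Int_bounds(1)[OF finite_C[of m], where y = y' and z = z']
    unfolding c card_x0 card_C by blast+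
  have "card (y \<inter> z \<inter> x0 m) = card (y' \<inter> z' \<inter> x0 m)"
    using eq_diff_iff[OF b(1,2)] o(3,7) by metis
  moreover have "card (y \<inter> z \<inter> C_set m) = card (y' \<inter> z' \<inter> C_set m)"
    using eq_diff_iff[OF b(3,4)] o(4,8) by metis
  ultimately show ?thesis using Terwilliger_orbit[OF assms(1) pq o(1,5,2,6)] by blast
qed

lemma sum_xmat_apply: "(\<Sum>i\<in>I. f i :: xmat) y z = (\<Sum>i\<in>I. f i y z)"
  by (induction I rule: infinite_finite_induct) auto

interpretation xvec: vector_space xsmult
  by unfold_locales (auto simp: xsmult_def fun_eq_iff algebra_simps)

lemma xadd_eq: "xadd M N = M + N"
  by (simp add: xadd_def fun_eq_iff)

lemma orb_unique:
  assumes "i \<in> idx m" "i' \<in> idx m" "orb m i y z \<noteq> 0" "orb m i' y z \<noteq> 0"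
  shows "i = i'"
proof -
  obtain j k p q where i: "i = (j, k, p, q)" by (metis surj_pair)
  obtain j' k' p' q' where i': "i' = (j', k', p', q')" by (metis surj_pair)
  have b: "p \<le> 2*m+1" "q \<le> 2*m+1" "p' \<le> 2*m+1" "q' \<le> 2*m+1"
    using assms(1,2) feasible_bounds(3) unfolding idx_def i i' by auto
  note o = orb_nonzeroD[OF assms(3)[unfolded i]] orb_nonzeroD[OF assms(4)[unfolded i']]
  have "p = p'" "q = q'" using level_unique o b by blast+
  then show ?thesis using o(3,4,7,8) unfolding i i' by metis
qed

lemma Terwilliger_span_orb: "Terwilliger m \<subseteq> xvec.span (orb m ` idx m)"
proof
  fix M assume M: "M \<in> Terwilliger m"
  \<comment> \<open>The coefficient is read off at an arbitrary representative of the orbit. A label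
    without any pair of vertices gets an arbitrary value, multiplied by the zero matrix.\<close>
  define F where "F i = (let w = SOME w. orb m i (fst w) (snd w) \<noteq> 0 in M (fst w) (snd w))" for i
  have F: "F i = M y z" if "i \<in> idx m" "orb m i y z \<noteq> 0" for i y z
  proof -
    have "orb m i (fst (SOME w. orb m i (fst w) (snd w) \<noteq> 0)) (snd (SOME w. orb m i (fst w) (snd w) \<noteq> 0)) \<noteq> 0"
      using that(2) by (intro someI[of "\<lambda>w. orb m i (fst w) (snd w) \<noteq> 0" "(y, z)"]) simp
    then show ?thesis unfolding F_def Let_def using Terwilliger_orb[OF M that(1) _ that(2)] by blast
  qed
  have "M = (\<Sum>i\<in>idx m. xsmult (F i) (orb m i))"
  proof (intro ext)
    fix y z
    have *: "(\<Sum>i\<in>idx m. xsmult (F i) (orb m i)) y z = (\<Sum>i\<in>idx m. F i * orb m i y z)"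
      by (simp add: sum_xmat_apply xsmult_def)
    show "M y z = (\<Sum>i\<in>idx m. xsmult (F i) (orb m i)) y z"
    proof (cases "y \<in> X_set m \<and> z \<in> X_set m")
      case True
      obtain p q where pq: "p \<le> 2*m+1" "q \<le> 2*m+1" "y \<in> level m p" "z \<in> level m q"
        using X_level True by metis
      obtain i where i: "i \<in> idx m" "orb m i y z = 1" using orb_idx[OF pq(3,4,1,2)] by blast
      have "(\<Sum>i\<in>idx m. F i * orb m i y z) = (\<Sum>l\<in>{i}. F l * orb m l y z)"
      proof (rule sum.mono_neutral_right[OF finite_idx])
        show "\<forall>l\<in>idx m - {i}. F l * orb m l y z = 0" using orb_unique i by fastforce
      qed (use i in auto)
      then show ?thesis using * i F[OF i(1), of y z] by simp
    next
      case False
      have "orb m i y z = 0" if "i \<in> idx m" for i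
      proof -
        obtain j k p q where ii: "i = (j, k, p, q)" by (metis surj_pair)
        have "p \<le> 2*m+1" "q \<le> 2*m+1" using that feasible_bounds(3) unfolding idx_def ii by auto
        then show ?thesis using False level_subset_X unfolding ii orb_def by auto
      qed
      then show ?thesis using * Terwilliger_outside[OF M] False by simp
    qed
  qed
  moreover have "(\<Sum>i\<in>idx m. xsmult (F i) (orb m i)) \<in> xvec.span (orb m ` idx m)"
    by (intro xvec.span_sum xvec.span_scale xvec.span_base) auto
  ultimately show "M \<in> xvec.span (orb m ` idx m)" by simp
qed

lemma subspace_Terwilliger: "xvec.subspace (Terwilliger m)"
proof (rule xvec.subspaceI)
  show "0 \<in> Terwilliger m"
    using Terwilliger.smult[OF Terwilliger.gen_A[of m], of 0] xvec.scale_zero_left[of "A1 m"] by simp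
qed (use Terwilliger.add Terwilliger.smult xadd_eq in metis)+

lemma coef_injective:
  assumes "M \<in> Terwilliger m" "N \<in> Terwilliger m" "\<And>i. i \<in> idx m \<Longrightarrow> coef m M i = coef m N i"
  shows "M = N"
proof -
  let ?D = "xadd M (xsmult (-1) N)"
  have D: "?D \<in> Terwilliger m" using assms by (intro Terwilliger.add Terwilliger.smult)
  have "?D = 0"
  proof (rule xvec.surjective_imp_injective[OF finite_idx subspace_Terwilliger Terwilliger_span_orb, where \<phi> = "coef m"])
    show "coef m (x + y) i = coef m x i + coef m y i" if "x \<in> Terwilliger m" "y \<in> Terwilliger m" for x y i
      using coef_xadd[OF that] by (simp add: xadd_eq)
    show "coef m (xsmult c x) i = c * coef m x i" if "x \<in> Terwilliger m" for c x i
      using coef_xsmult[OF that] by simp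
    show "\<exists>x\<in>Terwilliger m. \<forall>i\<in>idx m. coef m x i = (if i = l then 1 else 0)" if "l \<in> idx m" for l
    proof -
      have "(\<lambda>i. if i = l then 1 else 0) \<in> coefs m" using that by (auto simp: coefs_eq)
      then show ?thesis unfolding coefs_def
      proof (rule imageE)
        fix x assume x: "(\<lambda>i. if i = l then 1 else 0) = coef m x" "x \<in> Terwilliger m"
        show ?thesis using fun_cong[OF x(1), symmetric] x(2) by blast
      qed
    qed
    show "coef m ?D i = 0" if "i \<in> idx m" for i
      unfolding coef_xadd[OF assms(1) Terwilliger.smult[OF assms(2)]] coef_xsmult[OF assms(2)]
      using assms(3)[OF that] by simp
  qed (fact D)
  then show ?thesis by (simp add: xadd_def xsmult_def fun_eq_iff)
qed

section \<open>Regrouping the modules into the stated blocks\<close>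

text \<open>The block with parameter \<open>d\<close> collects the modules whose first sphere has radius
  \<open>m - d = max (2 j) (2 k - 1)\<close>; \<open>r\<close> enumerates the weight that does not attain this maximum.\<close>

definition jk :: "nat \<Rightarrow> nat \<times> nat \<Rightarrow> nat \<times> nat" where
  "jk m = (\<lambda>(d, r). if even (m - d) then ((m - d) div 2, r - 1) else (r - 1, (m - d + 1) div 2))"

text \<open>The numbers \<open>2 j\<close> and \<open>2 k - 1\<close> differ in parity, so there is
  no tie: the test \<open>k \<le> j\<close> says precisely that \<open>2 j\<close> is the larger
  one.\<close>

definition dr :: "nat \<Rightarrow> nat \<times> nat \<Rightarrow> nat \<times> nat" where
  "dr m = (\<lambda>(j, k). if k \<le> j then (m - 2 * j, k + 1) else (m + 1 - 2 * k, j + 1))"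

text \<open>Subtracting half of \<open>m - d\<close>, rounded up, leaves half of it rounded down.
  This is the number of values besides 0 available to the smaller weight.\<close>

lemma blocks_iff: "(d, r) \<in> blocks m \<longleftrightarrow> d \<le> m \<and> 1 \<le> r \<and> r \<le> (m - d) div 2 + 1"
proof -
  have "\<lceil>real n / 2\<rceil> = int ((n + 1) div 2)" for n :: nat
    by (cases "even n") (auto elim!: evenE oddE simp: ceiling_unique)
  then have "int n - \<lceil>real n / 2\<rceil> = int (n div 2)" for n :: nat by simp
  from this[of "m - d"] show ?thesis unfolding blocks_def by (auto simp: of_nat_diff)
qed

text \<open>The dominating weight alone determines the interval of feasible spheres; the bounds for
  the other weight then hold throughout it. The interval has \<open>2 * d + 2\<close> members, the
  size of the block.\<close>

lemma jk_blocks: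
  assumes "(d, r) \<in> blocks m" "jk m (d, r) = (j, k)"
  shows "2 * j \<le> m" "2 * k \<le> m + 1" "dr m (j, k) = (d, r)"
    "feasible m j k p \<longleftrightarrow> m - d \<le> p \<and> p \<le> m + d + 1"
proof -
  have d: "d \<le> m" "1 \<le> r" "r \<le> (m - d) div 2 + 1" using assms(1) blocks_iff by auto
  obtain e where e: "m = d + e" using d(1) le_Suc_ex by blast
  consider (ev) i where "e = 2 * i" "j = i" "k = r - 1" | (od) i where "e = 2 * i + 1" "j = r - 1" "k = i + 1"
    using assms(2) e by (cases "even e") (auto simp: jk_def elim!: evenE oddE)
  then have "2 * j \<le> m \<and> 2 * k \<le> m + 1 \<and> dr m (j, k) = (d, r) \<and>
    (feasible m j k p \<longleftrightarrow> m - d \<le> p \<and> p \<le> m + d + 1)"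
  proof cases
    case ev
    have "k \<le> i" using ev d e by simp
    have "feasible m j k p \<longleftrightarrow> 2 * i \<le> p \<and> p \<le> 2 * i + 2 * d + 1"
      using ev e \<open>k \<le> i\<close> by (cases "even p") (auto simp: feasible_def elim!: evenE oddE)
    then show ?thesis using ev d e \<open>k \<le> i\<close> by (auto simp: dr_def)
  next
    case od
    have "j \<le> i" using od d e by simp
    have "feasible m j k p \<longleftrightarrow> 2 * i + 1 \<le> p \<and> p \<le> 2 * i + 1 + 2 * d + 1"
      using od e \<open>j \<le> i\<close> by (cases "even p") (auto simp: feasible_def elim!: evenE oddE)
    then show ?thesis using od d e \<open>j \<le> i\<close> by (auto simp: dr_def)
  qed
  then show "2 * j \<le> m" "2 * k \<le> m + 1" "dr m (j, k) = (d, r)"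
    "feasible m j k p \<longleftrightarrow> m - d \<le> p \<and> p \<le> m + d + 1" by auto
qed

lemma dr_blocks:
  assumes "2 * j \<le> m" "2 * k \<le> m + 1"
  shows "dr m (j, k) \<in> blocks m" "jk m (dr m (j, k)) = (j, k)"
proof -
  have "dr m (j, k) \<in> blocks m \<and> jk m (dr m (j, k)) = (j, k)"
  proof (cases "k \<le> j")
    case True
    then have "m - (m - 2 * j) = 2 * j" using assms by simp
    then show ?thesis using True assms by (simp add: dr_def blocks_iff jk_def)
  next
    case False
    then have "m - (m + 1 - 2 * k) = 2 * (k - 1) + 1" using assms by simp
    then show ?thesis using False assms by (simp add: dr_def blocks_iff jk_def)
  qed
  then show "dr m (j, k) \<in> blocks m" "jk m (dr m (j, k)) = (j, k)" by auto
qed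

text \<open>Row and column 0 correspond to sphere \<open>m - d\<close>, the first one that the
  module meets. Outside \<open>blocks m\<close> the value is the empty matrix prescribed by
  \<open>dsum_alg\<close>.\<close>

definition block_mats :: "nat \<Rightarrow> xmat \<Rightarrow> nat \<times> nat \<Rightarrow> complex mat" where
  "block_mats m M = (\<lambda>(d, r). if (d, r) \<in> blocks m then
     mat (2 * d + 2) (2 * d + 2) (\<lambda>(s, t). coef m M (fst (jk m (d, r)), snd (jk m (d, r)), m - d + s, m - d + t))
     else 0\<^sub>m 0 0)"

lemma block_mats_in:
  assumes "(d, r) \<in> blocks m" "jk m (d, r) = (j, k)"
  shows "block_mats m M (d, r) = mat (2 * d + 2) (2 * d + 2) (\<lambda>(s, t). coef m M (j, k, m - d + s, m - d + t))"
  using assms by (simp add: block_mats_def)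

lemma block_mats_out: "(d, r) \<notin> blocks m \<Longrightarrow> block_mats m M (d, r) = 0\<^sub>m 0 0"
  by (simp add: block_mats_def)

lemma block_mats_xadd:
  assumes "M \<in> Terwilliger m" "N \<in> Terwilliger m"
  shows "block_mats m (xadd M N) = dadd (block_mats m M) (block_mats m N)"
  unfolding dadd_def block_mats_def coef_xadd[OF assms] by (rule ext) (auto intro!: eq_matI)

lemma block_mats_xsmult:
  assumes "M \<in> Terwilliger m"
  shows "block_mats m (xsmult c M) = dsmult c (block_mats m M)"
  unfolding dsmult_def block_mats_def coef_xsmult[OF assms] by (rule ext) (auto intro!: eq_matI)

lemma block_mats_xmult:
  assumes "M \<in> Terwilliger m" "N \<in> Terwilliger m"
  shows "block_mats m (xmult m M N) = dmult (block_mats m M) (block_mats m N)"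
proof (rule ext, clarify)
  fix d r
  show "block_mats m (xmult m M N) (d, r) = dmult (block_mats m M) (block_mats m N) (d, r)"
  proof (cases "(d, r) \<in> blocks m")
    case True
    obtain j k where jk: "jk m (d, r) = (j, k)" by fastforce
    have d: "d \<le> m" using True blocks_iff by auto
    show ?thesis unfolding dmult_def block_mats_in[OF True jk] coef_xmult[OF assms]
    proof (rule eq_matI)
      fix s t assume st: "s < dim_row (mat (2*d+2) (2*d+2) (\<lambda>(s, t). coef m M (j, k, m - d + s, m - d + t)) *
            mat (2*d+2) (2*d+2) (\<lambda>(s, t). coef m N (j, k, m - d + s, m - d + t)))"
          "t < dim_col (mat (2*d+2) (2*d+2) (\<lambda>(s, t). coef m M (j, k, m - d + s, m - d + t)) *
            mat (2*d+2) (2*d+2) (\<lambda>(s, t). coef m N (j, k, m - d + s, m - d + t)))"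
      then have st: "s < 2*d+2" "t < 2*d+2" by auto
      let ?g = "\<lambda>u. coef m M (j, k, m - d + s, u) * coef m N (j, k, u, m - d + t)"
      \<comment> \<open>Coefficients vanish off the feasible window, which lies inside the range of
        summation because \<open>d \<le> m\<close>; the sum over all spheres thus shrinks to a
        product of matrices of size \<open>2 * d + 2\<close>.\<close>
      have "(\<Sum>u\<le>2*m+1. ?g u) = (\<Sum>u\<in>{m - d..<m - d + (2*d+2)}. ?g u)"
        by (rule sum.mono_neutral_right) (use d jk_blocks(4)[OF True jk] in \<open>auto simp: coef_eq_0\<close>)
      also have "\<dots> = (\<Sum>u\<in>{0..<2*d+2}. ?g (m - d + u))"
        using sum.shift_bounds_nat_ivl[of ?g 0 "m - d" "2*d+2"] by (simp add: add.commute)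
      finally show "mat (2*d+2) (2*d+2) (\<lambda>(s, t). cmul m (coef m M) (coef m N) (j, k, m - d + s, m - d + t)) $$ (s, t) =
          (mat (2*d+2) (2*d+2) (\<lambda>(s, t). coef m M (j, k, m - d + s, m - d + t)) *
            mat (2*d+2) (2*d+2) (\<lambda>(s, t). coef m N (j, k, m - d + s, m - d + t))) $$ (s, t)"
        using st by (simp add: cmul_def scalar_prod_def)
    qed auto
  next
    case False
    then show ?thesis by (simp add: block_mats_out dmult_def)
  qed
qed

lemma block_mats_inj: "inj_on (block_mats m) (Terwilliger m)"
proof (rule inj_onI)
  fix M N assume MN: "M \<in> Terwilliger m" "N \<in> Terwilliger m" "block_mats m M = block_mats m N"
  show "M = N"
  proof (rule coef_injective[OF MN(1,2)])
    fix i assume "i \<in> idx m"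
    then obtain j k p q where i: "i = (j, k, p, q)" "feasible m j k p" "feasible m j k q" by (auto simp: idx_def)
    obtain d r where dr: "dr m (j, k) = (d, r)" by fastforce
    have b: "(d, r) \<in> blocks m" "jk m (d, r) = (j, k)"
      using dr_blocks[of j m k] feasible_bounds[OF i(2)] dr by auto
    have d: "d \<le> m" using b(1) blocks_iff by auto
    have pq: "m - d \<le> p" "p \<le> m + d + 1" "m - d \<le> q" "q \<le> m + d + 1"
      using jk_blocks(4)[OF b] i by auto
    have "block_mats m M (d, r) $$ (p - (m - d), q - (m - d)) = block_mats m N (d, r) $$ (p - (m - d), q - (m - d))"
      using MN(3) by simp
    then show "coef m M i = coef m N i"
      unfolding block_mats_in[OF b] using pq d i(1) by simp
  qed
qed

lemma block_mats_surj: "block_mats m ` Terwilliger m = dsum_alg m"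
proof
  show "block_mats m ` Terwilliger m \<subseteq> dsum_alg m"
    by (auto simp: dsum_alg_def block_mats_def)
next
  show "dsum_alg m \<subseteq> block_mats m ` Terwilliger m"
  proof
    fix B assume B: "B \<in> dsum_alg m"
    \<comment> \<open>The prescribed blocks are copied into the coordinates
      \<open>(j, k, p, q)\<close> and extended by 0, so that \<open>coefs_eq\<close> supplies a
      preimage.\<close>
    define f where "f = (\<lambda>(j, k, p, q). if feasible m j k p \<and> feasible m j k q then
       B (dr m (j, k)) $$ (p - (m - fst (dr m (j, k))), q - (m - fst (dr m (j, k)))) else 0)"
    have "f \<in> coefs m" unfolding coefs_eq by (auto simp: f_def idx_def)
    then obtain M where M: "M \<in> Terwilliger m" "coef m M = f" by (auto simp: coefs_def)
    have "block_mats m M = B"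
    proof (rule ext, clarify)
      fix d r
      show "block_mats m M (d, r) = B (d, r)"
      proof (cases "(d, r) \<in> blocks m")
        case True
        obtain j k where jk: "jk m (d, r) = (j, k)" by fastforce
        have d: "d \<le> m" using True blocks_iff by auto
        have carr: "B (d, r) \<in> carrier_mat (2*d+2) (2*d+2)"
          using B True unfolding dsum_alg_def by (metis (lifting) fst_conv mem_Collect_eq)
        have f: "f (j, k, m - d + s, m - d + t) = B (d, r) $$ (s, t)" if "s < 2*d+2" "t < 2*d+2" for s t
        proof -
          have "feasible m j k (m - d + s)" "feasible m j k (m - d + t)"
            unfolding jk_blocks(4)[OF True jk] using that d by linarith+
          then show ?thesis by (simp add: f_def jk_blocks(3)[OF True jk])
        qed
        show ?thesis unfolding block_mats_in[OF True jk] M(2)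
          using carr by (intro eq_matI) (simp_all only: f carrier_matD dim_row_mat dim_col_mat index_mat prod.case)
      next
        case False
        then show ?thesis using B by (simp add: block_mats_out dsum_alg_def)
      qed
    qed
    then show "B \<in> block_mats m ` Terwilliger m" using M(1) by blast
  qed
qed

theorem theorem4p8:
  fixes m :: nat
  assumes "m \<ge> 3"
  shows "\<exists>\<phi>. bij_betw \<phi> (Terwilliger m) (dsum_alg m)
           \<and> (\<forall>M\<in>Terwilliger m. \<forall>N\<in>Terwilliger m.
                 \<phi> (xadd M N) = dadd (\<phi> M) (\<phi> N)
               \<and> \<phi> (xmult m M N) = dmult (\<phi> M) (\<phi> N))
           \<and> (\<forall>c. \<forall>M\<in>Terwilliger m. \<phi> (xsmult c M) = dsmult c (\<phi> M))"
  using block_mats_inj block_mats_surj block_mats_xadd block_mats_xmult block_mats_xsmult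
  by (intro exI[of _ "block_mats m"]) (auto simp: bij_betw_def)

end
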